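(* For all integers $n \geq 1$ and $k \in \{0,1,\ldots,n-1\}$, the following two identities hold in $\mathbb{Z}[x]$: $$A_{n,k-1} - A_{n,k} = K_{n-1,k},$$ $$B_{n,k-1} - B_{n,n-k-1} = K_{n,k} - K_{n,k+1}.$$
   Context: **Chord diagrams.** For $n\ge 1$ an $n$-chord diagram is an oriented circle with $2n$ distinct points paired into $n$ disjoint pairs (chords), up to orientation-preserving diffeomorphism of the circle. It is represented by a tuple $((p_i,p_i^* ))_{1\le i\le n}$ with $\{p_1,p_1^*,\ldots,p_n,p_n^*\}=\{1,\ldots,2n\}$, $p_1<\cdots<p_n$ and $p_i<p_i^*$: points on the circle are labelled $1,\ldots,2n$ counterclockwise and $p_i$ is joined to $p_i^*$ (different tuples may represent the same diagram). **The weight $\varphi$.** To each $n$-chord diagram $\mathcal{D}$ one associates $\varphi(\mathcal{D})\in\mathbb{Z}[x]$ recursively: $\varphi=x$ on the unique $1$-chord diagram; for $n\ge2$, pick any chord $a$ of $\mathcal D$ (it is a known result that the value does not depend on the choice) and set $$\varphi(\mathcal{D})=(x-k)\varphi(\mathcal{D}_a)+\sum_{\{i,j\}\subset I_a}\left(\varphi(\mathcal{D}^1_{i,j})-\varphi(\mathcal{D}^2_{i,j})\right),$$ where $\mathcal{D}_a$ is $\mathcal{D}$ with $a$ deleted; $I_a$ is the set of indices of the chords of $\mathcal D$ that cross $a$; $k=\#I_a$; the sum is over two-element subsets of $I_a$; for $i\in I_a$, $q_i$ is the endpoint of chord $i$ lying on one fixed side of $a$ (the same side for all $i \in I_a$)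 and $q_i^*$ is its other endpoint; $\mathcal{D}^1_{i,j}$ (resp. $\mathcal{D}^2_{i,j}$) is obtained from $\mathcal{D}_a$ by replacing the chords $i$ and $j$ by $(q_i,q_j)$ and $(q_i^*,q_j^* )$ (resp. by $(q_i,q_j^* )$ and $(q_j,q_i^* )$). **The polynomials $D_n$.** $\mathcal{D}_n=((i,n+i))_{1\le i\le n}$ is the $n$-chord diagram in which every two chords cross; $D_n=\varphi(\mathcal{D}_n)$ for $n\ge1$, and $D_0=1$. **The polynomials $A_{n,k}$, $B_{n,k}$.** Let $n\ge1$, $0\le k\le n-1$. $\mathcal{A}_{n,k}$ is the $n$-chord diagram whose endpoints, read counterclockwise, are $$p_1,p_2,\ldots,p_{k+1},\;p_1^*,\;p_{k+2},\ldots,p_n,\;p_2^*,p_3^*,\ldots,p_n^*.$$ For $0\le k\le n-2$, $\mathcal{B}_{n,k}$ is the $n$-chord diagram whose endpoints, read counterclockwise, are $$p_1,p_2,\ldots,p_{k+1},\;p_1^*,\;p_{k+2},\ldots,p_{n-1},p_n,\;p_2^*,\ldots,p_{k+1}^*,\;p_n^*,\;p_{k+2}^*,\ldots,p_{n-1}^*,$$ and $\mathcal{B}_{n,n-1}=\mathcal{D}_n$. Set $A_{n,k}=\varphi(\mathcal{A}_{n,k})$ and $B_{n,k}=\varphi(\mathcal{B}_{n,k})$; also $A_{n,-1}=0$ and $B_{n,-1}=-xD_n$. **The polynomials $K_{n,k}$.** The family $(K_{n,k})_{1\le k\le n}$ in $\mathbb{Z}[x]$ is defined by $K_{1,1}=x$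 and, for $n\ge2$ and $3\le k\le n$, $$K_{n,1}=(x-1)K_{n-1,1}-K_{n-1,2}-\cdots-K_{n-1,n-1},$$ $$K_{n,2}=2K_{n,1}+K_{n-1,1}-x^2K_{n-2,1},$$ $$K_{n,k}=2K_{n,k-1}-K_{n,k-2}+K_{n-1,k-1}+K_{n-1,k-2}+2xK_{n-2,k-2},$$ with the conventions $K_{0,1}=1$ and $K_{n,0}=-xK_{n,1}$ for all $n\ge0$. *)

theory Defs
  imports "HOL-Computational_Algebra.Polynomial"
begin

text \<open>
  A chord is a two-element set of labels, a chord diagram a finite set of pairwise disjoint
  chords. The labels are natural numbers, placed counterclockwise on the circle in increasing
  order. They need not be \<open>1, \<dots>, 2n\<close>: deleting chords leaves gaps, which is harmless because a
  diagram only depends on the cyclic order of its endpoints.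
\<close>

type_synonym chord = "nat set"

definition chord_diagram :: "chord set \<Rightarrow> bool" where
  "chord_diagram D \<longleftrightarrow>
     finite D \<and> (\<forall>a\<in>D. card a = 2) \<and> (\<forall>a\<in>D. \<forall>b\<in>D. a \<noteq> b \<longrightarrow> a \<inter> b = {})"

text \<open>
  The side of a chord \<open>a\<close> that is fixed in the recursion for the weight consists of the points
  strictly between the two endpoints of \<open>a\<close>. A chord disjoint from \<open>a\<close> crosses \<open>a\<close> iff exactly
  one of its endpoints is on that side.
\<close>

definition side :: "chord \<Rightarrow> nat set" where
  "side a = {Min a<..<Max a}"

definition crossing :: "chord set \<Rightarrow> chord \<Rightarrow> chord set" where
  "crossing D a = {b \<in> D. card (b \<inter> side a) = 1}"

text \<open>For a chord \<open>b\<close> crossing \<open>a\<close>, these are the endpoints \<open>q\<close> and \<open>q\<^sup>*\<close> of \<open>b\<close>.\<close>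

definition inner_end :: "chord \<Rightarrow> chord \<Rightarrow> nat" where
  "inner_end a b = (THE q. q \<in> b \<and> q \<in> side a)"

definition outer_end :: "chord \<Rightarrow> chord \<Rightarrow> nat" where
  "outer_end a b = (THE q. q \<in> b \<and> q \<notin> side a)"

definition crossing_pairs :: "chord set \<Rightarrow> chord \<Rightarrow> chord set set" where
  "crossing_pairs D a = {S. S \<subseteq> crossing D a \<and> card S = 2}"

text \<open>
  For \<open>S = {b, c}\<close>, the chords added by \<open>resolve1\<close> are \<open>{q\<^sub>b, q\<^sub>c}\<close> and \<open>{q\<^sub>b\<^sup>*, q\<^sub>c\<^sup>*}\<close>, those added
  by \<open>resolve2\<close> are \<open>{q\<^sub>b, q\<^sub>c\<^sup>*}\<close> and \<open>{q\<^sub>c, q\<^sub>b\<^sup>*}\<close>.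
\<close>

definition resolve1 :: "chord set \<Rightarrow> chord \<Rightarrow> chord set \<Rightarrow> chord set" where
  "resolve1 D a S = (D - {a} - S) \<union> {inner_end a ` S, outer_end a ` S}"

definition resolve2 :: "chord set \<Rightarrow> chord \<Rightarrow> chord set \<Rightarrow> chord set" where
  "resolve2 D a S =
     (D - {a} - S) \<union> {{inner_end a b, outer_end a c} | b c. b \<in> S \<and> c \<in> S \<and> b \<noteq> c}"

abbreviation X :: "int poly" where
  "X \<equiv> [:0, 1:]"

text \<open>
  \<open>weight D p\<close> says that \<open>p\<close> can be computed from \<open>D\<close> by the recursion, with an arbitrary chord
  \<open>a\<close> chosen at every step. It is known that each diagram with at least one chord has exactly one
  weight, and \<open>phi\<close> is this value.
\<close>

inductive weight :: "chord set \<Rightarrow> int poly \<Rightarrow> bool" where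
  one_chord: "weight D X" if "chord_diagram D" "card D = 1"
| step: "weight D ((X - of_nat (card (crossing D a))) * p
           + (\<Sum>S\<in>crossing_pairs D a. f S - g S))"
    if "chord_diagram D" "card D \<ge> 2" "a \<in> D"
       "weight (D - {a}) p"
       "\<And>S. S \<in> crossing_pairs D a \<Longrightarrow> weight (resolve1 D a S) (f S)"
       "\<And>S. S \<in> crossing_pairs D a \<Longrightarrow> weight (resolve2 D a S) (g S)"

definition phi :: "chord set \<Rightarrow> int poly" where
  "phi D = (THE p. weight D p)"

text \<open>
  A diagram given by reading its endpoints counterclockwise: the letter \<open>i\<close> stands for both \<open>p\<^sub>i\<close>
  and \<open>p\<^sub>i\<^sup>*\<close>, and equal letters are joined. The positions are labelled from 1.
\<close>

definition diagram_of_word :: "nat list \<Rightarrow> chord set" where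
  "diagram_of_word w = {{Suc i, Suc j} | i j. i < j \<and> j < length w \<and> w ! i = w ! j}"

definition D_diagram :: "nat \<Rightarrow> chord set" where
  "D_diagram n = {{i, n + i} | i. 1 \<le> i \<and> i \<le> n}"

definition D_poly :: "nat \<Rightarrow> int poly" where
  "D_poly n = (if n = 0 then 1 else phi (D_diagram n))"

definition A_diagram :: "nat \<Rightarrow> nat \<Rightarrow> chord set" where
  "A_diagram n k = diagram_of_word ([1..<k+2] @ [1] @ [k+2..<n+1] @ [2..<n+1])"

definition B_diagram :: "nat \<Rightarrow> nat \<Rightarrow> chord set" where
  "B_diagram n k =
     (if k + 1 = n then D_diagram n
      else diagram_of_word ([1..<k+2] @ [1] @ [k+2..<n+1] @ [2..<k+2] @ [n] @ [k+2..<n]))"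

text \<open>The second index is an integer because the value \<open>-1\<close> is allowed.\<close>

definition A_poly :: "nat \<Rightarrow> int \<Rightarrow> int poly" where
  "A_poly n k = (if k = -1 then 0 else phi (A_diagram n (nat k)))"

definition B_poly :: "nat \<Rightarrow> int \<Rightarrow> int poly" where
  "B_poly n k = (if k = -1 then - X * D_poly n else phi (B_diagram n (nat k)))"

text \<open>The values \<open>K_poly 0 k\<close> for \<open>k \<ge> 2\<close> and \<open>K_poly n k\<close> for \<open>k > n \<ge> 1\<close> are dummies.\<close>

function K_poly :: "nat \<Rightarrow> nat \<Rightarrow> int poly" where
  "K_poly n k =
     (if k = 0 then - X * K_poly n 1
      else if n = 0 then (if k = 1 then 1 else 0)
      else if n < k then 0
      else if n = 1 then X
      else if k = 1 then (X - 1) * K_poly (n-1) 1 - (\<Sum>j=2..n-1. K_poly (n-1) j)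
      else if k = 2 then 2 * K_poly n 1 + K_poly (n-1) 1 - X^2 * K_poly (n-2) 1
      else 2 * K_poly n (k-1) - K_poly n (k-2) + K_poly (n-1) (k-1) + K_poly (n-1) (k-2)
             + 2 * X * K_poly (n-2) (k-2))"
  by pat_completeness auto
termination
  by (relation "measures [\<lambda>(n, k). n, \<lambda>(n, k). if k = 0 then 2 else k]") auto

declare K_poly.simps [simp del]

end

theory Submission
  imports Defs Complex_Main "HOL-Library.FuncSet"
begin

text \<open>
  The weight is the weight system of the Lie algebra \<open>so(3)\<close>. Colour each chord of a diagram
  with a basis element \<open>J\<^sub>1, J\<^sub>2, J\<^sub>3\<close>, multiply the colours of the endpoints in their order
  along the circle, and sum over all colourings. The result lies in the subalgebra generated
  by the Casimir element; in a representation where that element acts as the scalar \<open>x\<close> it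
  is the value of the weight at \<open>x\<close>. Indeed, moving one end of a chord \<open>a\<close> next to the other
  end produces brackets with the endpoints passed, and contracting them with the identity
  \<open>\<epsilon> \<epsilon> = \<delta> \<delta> - \<delta> \<delta>\<close> gives exactly the recursion of the weight along \<open>a\<close>
  (\<open>contract_over_block\<close>, \<open>colour_sum_recursion\<close>). As this works for each chord and each
  integer \<open>x\<close>, the weight is unique (\<open>weight_unique\<close>), and \<open>phi\<close> may be computed with words
  of colours.

  In this language the difference of two diagrams that differ by interchanging two adjacent
  endpoints is a bracket, that is, a diagram with a trivalent vertex. The difference
  \<open>A\<^sub>n\<^sub>,\<^sub>k\<^sub>-\<^sub>1 - A\<^sub>n\<^sub>,\<^sub>k\<close> is of this kind: in the complete diagram on \<open>n - 1\<close> chords the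
  chord number \<open>k\<close> is replaced by a trivalent vertex (\<open>tripod_sum\<close>). Moving the vertex on to
  the next chord produces double brackets, which resolve into chords again, and the
  resulting diagrams belong to the family \<open>\<A>\<close> up to rotation (\<open>tripod_sum_difference\<close>). A
  second difference is the three-term recursion of \<open>K\<^sub>n\<^sub>,\<^sub>k\<close>, where the symmetry
  \<open>K\<^sub>n\<^sub>,\<^sub>k = K\<^sub>n\<^sub>,\<^sub>n\<^sub>+\<^sub>1\<^sub>-\<^sub>k\<close> (\<open>tripod_sum_commute\<close>) identifies the terms that come from
  opposite sides. The value \<open>K\<^sub>n\<^sub>,\<^sub>1\<close> is that of the complete diagram, which is found by
  telescoping the differences of the \<open>A\<^sub>n\<^sub>,\<^sub>k\<close>.

  For the second identity, \<open>K\<^sub>n\<^sub>,\<^sub>k - K\<^sub>n\<^sub>,\<^sub>k\<^sub>+\<^sub>1\<close> compares two positions of the trivalent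
  vertex. Rotating the last endpoint of the complete diagram to the front makes these
  positions differ only by whether the third leg lies before or after one end of a chord.
  The difference is a bracket, hence a tree with four legs, and resolving its inner edge
  gives the two diagrams of the family \<open>\<B>\<close> (\<open>B_sum_difference\<close>).
\<close>

section \<open>The algebra of colours\<close>

datatype colour = C1 | C2 | C3

lemma UNIV_colour: "UNIV = {C1, C2, C3}"
  using colour.exhaust by auto

instance colour :: finite
  by standard (simp add: UNIV_colour)

lemma sum_colour: "(\<Sum>a\<in>UNIV. f a) = f C1 + f C2 + f C3" for f :: "colour \<Rightarrow> 'a::comm_monoid_add"
  by (simp add: UNIV_colour add.assoc)

text \<open>
  The structure constants of \<open>so(3)\<close> in the basis of angular momentum operators: \<open>eps\<close> is
  \<open>\<i>\<close> times the Levi-Civita symbol, so that \<open>[J\<^sub>1, J\<^sub>2] = \<i> J\<^sub>3\<close> and cyclically. With this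
  factor the Killing form is a positive multiple of the standard inner product, and the
  chord tensor is the identity matrix in the colours of its two ends.
\<close>

fun eps :: "colour \<Rightarrow> colour \<Rightarrow> colour \<Rightarrow> complex" where
  "eps C1 C2 C3 = \<i>"
| "eps C2 C3 C1 = \<i>"
| "eps C3 C1 C2 = \<i>"
| "eps C2 C1 C3 = - \<i>"
| "eps C3 C2 C1 = - \<i>"
| "eps C1 C3 C2 = - \<i>"
| "eps _ _ _ = 0"

lemma eps_swap: "eps b a c = - eps a b c"
  by (cases a; cases b; cases c) simp_all

lemma eps_rotate: "eps b c a = eps a b c"
  by (cases a; cases b; cases c) simp_all

lemma eps_same [simp]: "eps a a c = 0"
  by (cases a; cases c) simp_all

text \<open>
  The three-dimensional identity that turns two trivalent vertices joined by an edge into a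
  difference of two pairs of chords. The difference of the two resolutions in the recursion
  of the weight comes from here.
\<close>

lemma eps_contract:
  "(\<Sum>a\<in>UNIV. eps a b c * eps a d e)
     = (if b = e \<and> c = d then 1 else 0) - (if b = d \<and> c = e then 1 else 0)"
  by (cases b; cases c; cases d; cases e) (simp_all add: sum_colour)

text \<open>
  The product \<open>J\<^sub>w\<close> of operators spelled by a word, applied to the constant function 1 on
  the integers. In the basis of delta functions \<open>v\<^sub>m\<close> the operators are \<open>J\<^sub>3 v\<^sub>m = m v\<^sub>m\<close>,
  \<open>J\<^sub>+ v\<^sub>m = v\<^sub>m\<^sub>+\<^sub>1\<close>, \<open>J\<^sub>- v\<^sub>m = (x - m (m - 1)) v\<^sub>m\<^sub>-\<^sub>1\<close>, with \<open>J\<^sub>1 = (J\<^sub>+ + J\<^sub>-) / 2\<close> and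
  \<open>J\<^sub>2 = (J\<^sub>+ - J\<^sub>-) / 2\<i>\<close>. The coefficient of \<open>J\<^sub>-\<close> is what makes the Casimir operator act
  as the scalar \<open>x\<close>; no bound on \<open>m\<close> is imposed, so every \<open>x\<close> is allowed.
\<close>

primrec spin_word :: "int \<Rightarrow> colour list \<Rightarrow> int \<Rightarrow> complex" where
  "spin_word x [] m = 1"
| "spin_word x (a # w) m =
     (case a of
        C1 \<Rightarrow> (spin_word x w (m - 1) + of_int (x - m * (m + 1)) * spin_word x w (m + 1)) / 2
      | C2 \<Rightarrow> (spin_word x w (m - 1) - of_int (x - m * (m + 1)) * spin_word x w (m + 1)) / (2 * \<i>)
      | C3 \<Rightarrow> of_int m * spin_word x w m)"

text \<open>
  The operators are linear, so a linear relation between words survives prefixing.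
\<close>

lemma spin_word_relation_prefix:
  assumes "\<And>m. (\<Sum>j\<in>J. s j * spin_word x (t j) m) = 0"
  shows "(\<Sum>j\<in>J. s j * spin_word x (u @ t j) m) = 0"
proof (induction u arbitrary: m)
  case Nil
  show ?case using assms by simp
next
  case (Cons a u)
  have lin: "(\<Sum>j\<in>J. s j * ((spin_word x (u @ t j) k + q * spin_word x (u @ t j) l) / r)) = 0"
    for k l q r
  proof -
    have "(\<Sum>j\<in>J. s j * ((spin_word x (u @ t j) k + q * spin_word x (u @ t j) l) / r))
        = ((\<Sum>j\<in>J. s j * spin_word x (u @ t j) k)
            + q * (\<Sum>j\<in>J. s j * spin_word x (u @ t j) l)) / r"
      by (simp add: sum_distrib_left sum_divide_distrib sum.distrib[symmetric] algebra_simps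
          add_divide_distrib)
    then show ?thesis by (simp add: Cons)
  qed
  show ?case
  proof (cases a)
    case C1
    then show ?thesis
      using lin[of "m - 1" "of_int (x - m * (m + 1))" "m + 1" 2] by simp
  next
    case C2
    then show ?thesis
      using lin[of "m - 1" "- of_int (x - m * (m + 1))" "m + 1" "2 * \<i>"]
      by (simp add: minus_mult_left[symmetric] del: of_int_diff of_int_mult of_int_minus minus_diff_eq)
  next
    case C3
    then show ?thesis
      using lin[of m "of_int m - 1" m 1] by (simp add: algebra_simps)
  qed
qed

lemma spin_word_bracket:
  "spin_word x (a # b # v) m
     = spin_word x (b # a # v) m + (\<Sum>c\<in>UNIV. eps a b c * spin_word x (c # v) m)"
  by (cases a; cases b) (simp_all add: sum_colour field_simps)

lemma spin_word_casimir:
  "(\<Sum>a\<in>UNIV. spin_word x (a # a # v) m) = of_int x * spin_word x v m"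
  by (simp add: sum_colour field_simps)

text \<open>
  All that is used of the representation: a linear functional on the universal enveloping
  algebra of \<open>so(3)\<close>, given by its values on words in the generators, that factors through
  the quotient in which the Casimir element is the scalar \<open>x\<close>.
\<close>

locale casimir_functional =
  fixes L :: "colour list \<Rightarrow> complex" and x :: complex
  assumes L_Nil: "L [] = 1"
    and bracket: "L (u @ a # b # v) = L (u @ b # a # v) + (\<Sum>c\<in>UNIV. eps a b c * L (u @ c # v))"
    and casimir: "(\<Sum>a\<in>UNIV. L (u @ a # a # v)) = x * L (u @ v)"

lemma sum_option:
  "(\<Sum>j\<in>UNIV. F j) = F None + (\<Sum>c\<in>UNIV. F (Some c))"
  for F :: "'b::finite option \<Rightarrow> 'a::comm_monoid_add"
  by (simp add: UNIV_option_conv sum.reindex)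

lemma spin_word_functional: "casimir_functional (\<lambda>w. spin_word x w 0) (of_int x)"
proof
  show "spin_word x [] 0 = 1" by simp
next
  fix u v :: "colour list" and a b :: colour
  let ?t = "case_option (b # a # v) (case_option (a # b # v) (\<lambda>c. c # v))"
  let ?s = "case_option (1::complex) (case_option (- 1) (eps a b))"
  have "(\<Sum>j\<in>UNIV. ?s j * spin_word x (u @ ?t j) 0) = 0"
    by (rule spin_word_relation_prefix)
      (simp add: sum_option spin_word_bracket[of x a b v] del: spin_word.simps)
  then show "spin_word x (u @ a # b # v) 0
      = spin_word x (u @ b # a # v) 0 + (\<Sum>c\<in>UNIV. eps a b c * spin_word x (u @ c # v) 0)"
    by (simp add: sum_option algebra_simps del: spin_word.simps)
next
  fix u v :: "colour list"
  let ?t = "case_option v (\<lambda>a. a # a # v)"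
  let ?s = "case_option (- of_int x :: complex) (\<lambda>a. 1)"
  have "(\<Sum>j\<in>UNIV. ?s j * spin_word x (u @ ?t j) 0) = 0"
    by (rule spin_word_relation_prefix)
      (simp add: sum_option spin_word_casimir del: spin_word.simps)
  then show "(\<Sum>a\<in>UNIV. spin_word x (u @ a # a # v) 0) = of_int x * spin_word x (u @ v) 0"
    by (simp add: sum_option algebra_simps del: spin_word.simps)
qed

section \<open>Contracting a chord\<close>

context casimir_functional
begin

text \<open>
  Carrying a letter to the front of a block costs one bracket with each letter that it
  passes. The block is given by a colouring of distinct positions, because later the colours
  of several positions are tied together by chords.
\<close>

lemma slide_left:
  assumes "distinct ps"
  shows "L (u @ map c ps @ a # v) = L (u @ a # map c ps @ v)
    + (\<Sum>q\<in>set ps. \<Sum>d\<in>UNIV. eps (c q) a d * L (u @ map (c(q := d)) ps @ v))"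
  using assms
proof (induction ps arbitrary: u)
  case Nil
  then show ?case by simp
next
  case (Cons p ps)
  have upd: "map (c(q := d)) (p # ps) = c p # map (c(q := d)) ps" if "q \<in> set ps" for q d
    using that Cons.prems by auto
  have "L (u @ c p # map c ps @ a # v) = L (u @ c p # a # map c ps @ v)
      + (\<Sum>q\<in>set ps. \<Sum>d\<in>UNIV. eps (c q) a d * L (u @ map (c(q := d)) (p # ps) @ v))"
    using Cons.IH[of "u @ [c p]"] Cons.prems by (simp add: upd del: list.map fun_upd_apply)
  also have "L (u @ c p # a # map c ps @ v) = L (u @ a # c p # map c ps @ v)
      + (\<Sum>d\<in>UNIV. eps (c p) a d * L (u @ map (c(p := d)) (p # ps) @ v))"
    using bracket[of u "c p" a "map c ps @ v"] Cons.prems by simp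
  finally show ?case
    using Cons.prems by (simp add: add.assoc del: fun_upd_apply)
qed

lemma bracket_contracted:
  "(\<Sum>a\<in>UNIV. \<Sum>e\<in>UNIV. eps a b e * L (u @ e # a # v)) = - L (u @ b # v)"
proof -
  have *: "\<i> * L (u @ c # d # v) - \<i> * L (u @ d # c # v) = \<i> * (\<Sum>e\<in>UNIV. eps c d e * L (u @ e # v))"
    for c d using bracket[of u c d v] by (simp add: algebra_simps)
  show ?thesis
    using *[of C1 C2] *[of C2 C3] *[of C3 C1]
    by (cases b) (simp_all add: sum_colour mult.assoc[symmetric])
qed

text \<open>
  The contribution of two positions inside a chord to its recursion: the tensor \<open>\<delta> \<delta> - \<delta> \<delta>\<close>
  of the identity for two structure constants, applied to the letters at \<open>p\<close> and \<open>q\<close>. The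
  first term joins \<open>p\<close> to \<open>q\<close> and, through the condition on \<open>c\<close>, their partners; the second
  one interchanges the partners.
\<close>

definition exchange :: "colour list \<Rightarrow> colour list \<Rightarrow> 'p list \<Rightarrow> ('p \<Rightarrow> colour) \<Rightarrow> 'p \<Rightarrow> 'p \<Rightarrow> complex" where
  "exchange u v ps c p q =
     (if c p = c q then \<Sum>d\<in>UNIV. L (u @ map (c(p := d, q := d)) ps @ v) else 0)
       - L (u @ map (c(p := c q, q := c p)) ps @ v)"

lemma exchange_commute: "exchange u v ps c p q = exchange u v ps c q p"
  unfolding exchange_def
  by (cases "p = q") (auto simp: fun_upd_twist)

text \<open>
  The recursion of the weight in terms of words. Moving the first \<open>a\<close> to the right until the
  two letters \<open>a\<close> are adjacent gives \<open>x\<close>, and a bracket with each letter \<open>b\<close> of the block.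
  Then the second \<open>a\<close> is carried back to this bracket: it produces \<open>- b\<close> when they meet
  (\<open>bracket_contracted\<close>) and an exchange of \<open>b\<close> with each letter passed. The sum is over
  ordered pairs, hence the factor 2.
\<close>

lemma contract_over_block:
  assumes "distinct ps"
  shows "2 * (\<Sum>a\<in>UNIV. L (u @ a # map c ps @ a # v))
    = 2 * (x - of_nat (length ps)) * L (u @ map c ps @ v)
      + (\<Sum>p\<in>set ps. \<Sum>q\<in>set ps - {p}. exchange u v ps c p q)"
  using assms
proof (induction ps arbitrary: u)
  case Nil
  then show ?case using casimir[of u v] by simp
next
  case (Cons p ps)
  let ?G = "exchange u v (p # ps) c"
  have p: "p \<notin> set ps" and "distinct ps" using Cons.prems by auto
  have IH: "2 * (\<Sum>a\<in>UNIV. L (u @ c p # a # map c ps @ a # v))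
    = 2 * (x - of_nat (length ps)) * L (u @ map c (p # ps) @ v)
      + (\<Sum>q\<in>set ps. \<Sum>r\<in>set ps - {q}. ?G q r)"
  proof -
    have "exchange (u @ [c p]) v ps c q r = ?G q r" if "q \<in> set ps" "r \<in> set ps" for q r
    proof -
      have "p \<noteq> q" "p \<noteq> r" using that p by auto
      then show ?thesis by (simp add: exchange_def)
    qed
    then show ?thesis
      using Cons.IH[OF \<open>distinct ps\<close>, of "u @ [c p]"] by simp
  qed
  have one: "(\<Sum>a\<in>UNIV. \<Sum>e\<in>UNIV. eps a (c p) e * (\<Sum>d\<in>UNIV. eps (c q) a d *
        L (u @ e # map (c(q := d)) ps @ v))) = ?G p q" if q: "q \<in> set ps" for q
  proof -
    let ?T = "\<lambda>e d. L (u @ e # map (c(q := d)) ps @ v)"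
    have pq: "p \<noteq> q" using p q by auto
    have upd: "map (c(p := e, q := d)) (p # ps) = e # map (c(q := d)) ps" for e d
      using pq p by (auto simp: fun_upd_def)
    have "(\<Sum>a\<in>UNIV. \<Sum>e\<in>UNIV. eps a (c p) e * (\<Sum>d\<in>UNIV. eps (c q) a d * ?T e d))
        = (\<Sum>a\<in>UNIV. \<Sum>e\<in>UNIV. \<Sum>d\<in>UNIV. eps a (c p) e * eps a d (c q) * ?T e d)"
      by (simp add: sum_distrib_left mult.assoc eps_rotate)
    also have "\<dots> = (\<Sum>e\<in>UNIV. \<Sum>d\<in>UNIV. (\<Sum>a\<in>UNIV. eps a (c p) e * eps a d (c q)) * ?T e d)"
      by (subst sum.swap, rule sum.cong[OF refl], subst sum.swap) (simp add: sum_distrib_right)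
    also have "\<dots> = (\<Sum>e\<in>UNIV. \<Sum>d\<in>UNIV. if c p = c q \<and> e = d then ?T e d else 0)
        - (\<Sum>e\<in>UNIV. \<Sum>d\<in>UNIV. if c p = d \<and> e = c q then ?T e d else 0)"
      unfolding eps_contract by (simp add: sum_subtractf[symmetric] left_diff_distrib
          if_distrib[of "\<lambda>y. y * _"] cong: if_cong)
    also have "(\<Sum>e\<in>UNIV. \<Sum>d\<in>UNIV. if c p = d \<and> e = c q then ?T e d else 0) = ?T (c q) (c p)"
      by (cases "c p"; cases "c q"; simp add: sum_colour)
    also have "(\<Sum>e\<in>UNIV. \<Sum>d\<in>UNIV. if c p = c q \<and> e = d then ?T e d else 0)
        = (if c p = c q then \<Sum>d\<in>UNIV. ?T d d else 0)"
      by simp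
    finally show ?thesis
      by (simp add: exchange_def upd del: list.map fun_upd_apply)
  qed
  have "(\<Sum>a\<in>UNIV. L (u @ a # c p # map c ps @ a # v))
      = (\<Sum>a\<in>UNIV. L (u @ c p # a # map c ps @ a # v))
        + (\<Sum>a\<in>UNIV. \<Sum>e\<in>UNIV. eps a (c p) e * L (u @ e # map c ps @ a # v))"
    by (subst bracket) (simp add: sum.distrib)
  also have "(\<Sum>a\<in>UNIV. \<Sum>e\<in>UNIV. eps a (c p) e * L (u @ e # map c ps @ a # v))
      = (\<Sum>a\<in>UNIV. \<Sum>e\<in>UNIV. eps a (c p) e * L (u @ e # a # map c ps @ v))
        + (\<Sum>a\<in>UNIV. \<Sum>e\<in>UNIV. eps a (c p) e * (\<Sum>q\<in>set ps. \<Sum>d\<in>UNIV. eps (c q) a d *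
            L (u @ e # map (c(q := d)) ps @ v)))"
    using slide_left[OF \<open>distinct ps\<close>, of "u @ [e]" c a v for e a]
    by (simp add: distrib_left sum.distrib)
  also have "(\<Sum>a\<in>UNIV. \<Sum>e\<in>UNIV. eps a (c p) e * L (u @ e # a # map c ps @ v))
      = - L (u @ map c (p # ps) @ v)"
    using bracket_contracted[of "c p" u "map c ps @ v"] by simp
  also have "(\<Sum>a\<in>UNIV. \<Sum>e\<in>UNIV. eps a (c p) e * (\<Sum>q\<in>set ps. \<Sum>d\<in>UNIV. eps (c q) a d *
            L (u @ e # map (c(q := d)) ps @ v))) = (\<Sum>q\<in>set ps. ?G p q)"
  proof -
    have "(\<Sum>a\<in>UNIV. \<Sum>e\<in>UNIV. eps a (c p) e * (\<Sum>q\<in>set ps. \<Sum>d\<in>UNIV. eps (c q) a d *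
            L (u @ e # map (c(q := d)) ps @ v)))
        = (\<Sum>q\<in>set ps. \<Sum>a\<in>UNIV. \<Sum>e\<in>UNIV. eps a (c p) e * (\<Sum>d\<in>UNIV. eps (c q) a d *
            L (u @ e # map (c(q := d)) ps @ v)))"
      by (simp only: sum_distrib_left, subst (2) sum.swap, rule sum.swap)
    then show ?thesis by (simp add: one)
  qed
  finally have "2 * (\<Sum>a\<in>UNIV. L (u @ a # map c (p # ps) @ a # v))
      = 2 * (\<Sum>a\<in>UNIV. L (u @ c p # a # map c ps @ a # v))
        - 2 * L (u @ map c (p # ps) @ v) + 2 * (\<Sum>q\<in>set ps. ?G p q)"
    by simp
  moreover have "(\<Sum>q\<in>set (p # ps). \<Sum>r\<in>set (p # ps) - {q}. ?G q r)
      = (\<Sum>q\<in>set ps. \<Sum>r\<in>set ps - {q}. ?G q r) + 2 * (\<Sum>q\<in>set ps. ?G p q)"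
  proof -
    have "(\<Sum>r\<in>set (p # ps) - {q}. ?G q r) = ?G p q + (\<Sum>r\<in>set ps - {q}. ?G q r)"
      if "q \<in> set ps" for q
    proof -
      have "set (p # ps) - {q} = insert p (set ps - {q})" using that p by auto
      then show ?thesis using p by (simp add: exchange_commute[of _ _ _ _ q p])
    qed
    moreover have "set (p # ps) - {p} = set ps" using p by auto
    ultimately show ?thesis using p by (simp add: sum.distrib)
  qed
  ultimately show ?case
    unfolding IH by (simp add: algebra_simps)
qed

end

section \<open>Colour sums of chord diagrams\<close>

definition constant_on_chords :: "chord set \<Rightarrow> (nat \<Rightarrow> colour) \<Rightarrow> bool" where
  "constant_on_chords E c \<longleftrightarrow> (\<forall>b\<in>E. \<forall>p\<in>b. \<forall>q\<in>b. c p = c q)"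

definition colourings :: "chord set \<Rightarrow> (nat \<Rightarrow> colour) set" where
  "colourings E = {c \<in> (\<Union>E) \<rightarrow>\<^sub>E UNIV. constant_on_chords E c}"

lemma mem_colourings:
  "c \<in> colourings E \<longleftrightarrow> (\<forall>p. p \<notin> \<Union>E \<longrightarrow> c p = undefined) \<and> constant_on_chords E c"
  by (auto simp: colourings_def PiE_iff extensional_def)

lemma constant_on_chords_upd:
  "p \<notin> \<Union>E \<Longrightarrow> constant_on_chords E (c(p := d)) \<longleftrightarrow> constant_on_chords E c"
  unfolding constant_on_chords_def by (intro ball_cong refl) auto

lemma constant_on_chords_insert:
  "constant_on_chords (insert {p, q} E) c \<longleftrightarrow> c p = c q \<and> constant_on_chords E c"
  by (auto simp: constant_on_chords_def)

lemma finite_colourings: "finite (\<Union>E) \<Longrightarrow> finite (colourings E)"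
  unfolding colourings_def by (simp add: finite_PiE)

lemma chord_diagram_disjoint:
  "chord_diagram D \<Longrightarrow> a \<in> D \<Longrightarrow> b \<in> D \<Longrightarrow> p \<in> a \<Longrightarrow> p \<in> b \<Longrightarrow> a = b"
  by (auto simp: chord_diagram_def)

lemma chord_diagram_subset: "chord_diagram D \<Longrightarrow> E \<subseteq> D \<Longrightarrow> chord_diagram E"
  unfolding chord_diagram_def by (meson finite_subset subsetD)

lemma chord_diagram_finite_points: "chord_diagram D \<Longrightarrow> finite (\<Union>D)"
  unfolding chord_diagram_def
  by (metis card_eq_0_iff finite_Union zero_neq_numeral)

lemma sum_unordered_pairs:
  fixes G :: "'a set \<Rightarrow> 'b::comm_semiring_1"
  assumes "finite A"
  shows "(\<Sum>b\<in>A. \<Sum>c\<in>A - {b}. G {b, c}) = 2 * (\<Sum>S | S \<subseteq> A \<and> card S = 2. G S)"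
  using assms
proof (induction A)
  case empty
  show ?case by (simp cong: conj_cong)
next
  case (insert y A)
  have subsets: "{S. S \<subseteq> insert y A \<and> card S = 2} = {S. S \<subseteq> A \<and> card S = 2} \<union> (\<lambda>c. {y, c}) ` A"
    (is "?l = ?r")
  proof
    show "?l \<subseteq> ?r"
    proof
      fix S assume "S \<in> ?l"
      then obtain b c where "S = {b, c}" "b \<noteq> c" "S \<subseteq> insert y A" by (auto simp: card_2_iff)
      then show "S \<in> ?r" by (auto simp: insert_commute)
    qed
    show "?r \<subseteq> ?l" using insert.hyps by (auto simp: card_2_iff)
  qed
  have "inj_on (\<lambda>c. {y, c}) A" by (auto simp: inj_on_def doubleton_eq_iff)
  then have "(\<Sum>S | S \<subseteq> insert y A \<and> card S = 2. G S)
      = (\<Sum>S | S \<subseteq> A \<and> card S = 2. G S) + (\<Sum>c\<in>A. G {y, c})"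
    unfolding subsets using insert.hyps
    by (subst sum.union_disjoint) (auto simp: sum.reindex)
  moreover have "(\<Sum>c\<in>insert y A - {b}. G {b, c}) = G {y, b} + (\<Sum>c\<in>A - {b}. G {b, c})" if "b \<in> A" for b
  proof -
    have "insert y A - {b} = insert y (A - {b})" using that insert.hyps by auto
    then show ?thesis using insert.hyps by (simp add: insert_commute)
  qed
  moreover have "insert y A - {y} = A" using insert.hyps by auto
  ultimately show ?case
    using insert by (simp add: sum.distrib mult_2 algebra_simps)
qed

context casimir_functional
begin

text \<open>
  The contraction of the word of endpoints with one copy of the Casimir tensor for each
  chord.
\<close>

definition colour_sum :: "chord set \<Rightarrow> complex" where
  "colour_sum E = (\<Sum>c\<in>colourings E. L (map c (sorted_list_of_set (\<Union>E))))"

text \<open>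
  For the two ends of one chord the first term of the exchange frees the colour of the
  chord, giving the factor 3, the dimension of \<open>so(3)\<close>, and the second term leaves the
  colouring as it is.
\<close>

lemma colour_sum_exchange_same:
  assumes "chord_diagram E" and "{p, q} \<in> E" and "p \<noteq> q"
  defines "W \<equiv> \<lambda>c. L (map c (sorted_list_of_set (\<Union>E)))"
  shows "(\<Sum>c\<in>colourings E. (if c p = c q then \<Sum>d\<in>UNIV. W (c(p := d, q := d)) else 0)
            - W (c(p := c q, q := c p))) = 2 * colour_sum E"
proof -
  define R where "R = E - {{p, q}}"
  have E: "E = insert {p, q} R" using assms by (auto simp: R_def)
  have R: "p \<notin> \<Union>R" "q \<notin> \<Union>R"
    using chord_diagram_disjoint[OF assms(1,2)] by (auto simp: R_def)
  have eq: "c p = c q" if "c \<in> colourings E" for c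
    using that by (simp add: E mem_colourings constant_on_chords_insert)
  have upd: "c(p := d, q := d) \<in> colourings E" if "c \<in> colourings E" for c d
    using that R assms(3) unfolding mem_colourings E constant_on_chords_insert
    by (simp add: constant_on_chords_upd)
  have "(\<Sum>c\<in>colourings E. \<Sum>d\<in>UNIV. W (c(p := d, q := d)))
      = (\<Sum>(c, d)\<in>colourings E \<times> UNIV. W (c(p := d, q := d)))"
    by (simp add: sum.cartesian_product)
  also have "\<dots> = (\<Sum>(c, d)\<in>colourings E \<times> (UNIV :: colour set). W c)"
    by (rule sum.reindex_bij_witness[where i = "\<lambda>(c, d). (c(p := d, q := d), c p)"
          and j = "\<lambda>(c, d). (c(p := d, q := d), c p)"])
      (use assms(3) upd in \<open>auto simp: eq\<close>)
  also have "\<dots> = 3 * colour_sum E"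
    by (simp add: sum.cartesian_product[symmetric] colour_sum_def W_def UNIV_colour sum_distrib_left)
  finally have "(\<Sum>c\<in>colourings E. \<Sum>d\<in>UNIV. W (c(p := d, q := d))) = 3 * colour_sum E" .
  moreover have "(\<Sum>c\<in>colourings E. W (c(p := c q, q := c p))) = colour_sum E"
    unfolding colour_sum_def W_def
    by (rule sum.cong[OF refl]) (simp add: eq fun_upd_idem)
  ultimately show ?thesis
    by (simp add: sum_subtractf eq)
qed

text \<open>
  For ends of distinct chords the exchange performs the two resolutions of these chords.
\<close>

lemma colour_sum_exchange_distinct:
  assumes "chord_diagram E" and "{p, p'} \<in> E" and "{q, q'} \<in> E"
    and "p \<noteq> p'" and "q \<noteq> q'" and "{p, p'} \<noteq> {q, q'}"
  defines "W \<equiv> \<lambda>c. L (map c (sorted_list_of_set (\<Union>E)))"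
    and "R \<equiv> E - {{p, p'}, {q, q'}}"
  shows "(\<Sum>c\<in>colourings E. (if c p = c q then \<Sum>d\<in>UNIV. W (c(p := d, q := d)) else 0)
            - W (c(p := c q, q := c p)))
    = colour_sum (R \<union> {{p, q}, {p', q'}}) - colour_sum (R \<union> {{p, q'}, {q, p'}})"
proof -
  have E: "E = insert {p, p'} (insert {q, q'} R)" using assms by (auto simp: R_def)
  have dist: "p \<noteq> q" "p \<noteq> q'" "p' \<noteq> q" "p' \<noteq> q'"
    using chord_diagram_disjoint[OF assms(1,2,3)] assms(6) by auto
  have R: "p \<notin> \<Union>R" "q \<notin> \<Union>R" "p' \<notin> \<Union>R" "q' \<notin> \<Union>R"
    using chord_diagram_disjoint[OF assms(1,2)] chord_diagram_disjoint[OF assms(1,3)]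
    by (auto simp: R_def)
  have fin: "finite (colourings E)"
    by (intro finite_colourings chord_diagram_finite_points assms)
  define R1 where "R1 = R \<union> {{p, q}, {p', q'}}"
  define R2 where "R2 = R \<union> {{p, q'}, {q, p'}}"
  have R1: "R1 = insert {p, q} (insert {p', q'} R)" and R2: "R2 = insert {p, q'} (insert {q, p'} R)"
    by (simp_all add: R1_def R2_def)
  have pts: "\<Union>R1 = \<Union>E" "\<Union>R2 = \<Union>E"
    by (auto simp: E R1 R2)
  let ?supp = "\<lambda>c. \<forall>r. r \<notin> \<Union>E \<longrightarrow> c r = undefined"
  have mem: "c \<in> colourings E \<longleftrightarrow> ?supp c \<and> c p = c p' \<and> c q = c q' \<and> constant_on_chords R c"
    "c \<in> colourings R1 \<longleftrightarrow> ?supp c \<and> c p = c q \<and> c p' = c q' \<and> constant_on_chords R c"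
    "c \<in> colourings R2 \<longleftrightarrow> ?supp c \<and> c p = c q' \<and> c q = c p' \<and> constant_on_chords R c" for c
    unfolding mem_colourings pts by (auto simp: E R1 R2 constant_on_chords_insert)
  have inE: "p \<in> \<Union>E" "q \<in> \<Union>E" by (auto simp: E)
  have idem: "c(p := d, q := e) = c" if "c p = d" "c q = e" for c :: "nat \<Rightarrow> colour" and d e
    using that by auto
  have "(\<Sum>c\<in>colourings E. if c p = c q then \<Sum>d\<in>UNIV. W (c(p := d, q := d)) else 0)
      = (\<Sum>(c, d)\<in>{c \<in> colourings E. c p = c q} \<times> UNIV. W (c(p := d, q := d)))"
    using fin by (simp add: sum.cartesian_product[symmetric] sum.inter_filter)
  also have "\<dots> = (\<Sum>c\<in>colourings R1. W c)"
    by (rule sum.reindex_bij_witness[where i = "\<lambda>c. (c(p := c p', q := c q'), c p)"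
          and j = "\<lambda>(c, d). c(p := d, q := d)"])
      (use dist assms(4,5) in \<open>auto simp: mem idem inE constant_on_chords_upd[OF R(1)]
          constant_on_chords_upd[OF R(2)] simp del: Union_iff\<close>)
  also have "\<dots> = colour_sum R1"
    unfolding colour_sum_def pts W_def ..
  finally have 1: "(\<Sum>c\<in>colourings E. if c p = c q then \<Sum>d\<in>UNIV. W (c(p := d, q := d)) else 0)
      = colour_sum R1" .
  have "(\<Sum>c\<in>colourings E. W (c(p := c q, q := c p)))
      = (\<Sum>c\<in>colourings R2. W c)"
    by (rule sum.reindex_bij_witness[where i = "\<lambda>c. c(p := c q, q := c p)"
          and j = "\<lambda>c. c(p := c q, q := c p)"])
      (use dist assms(4,5) in \<open>auto simp: mem idem inE constant_on_chords_upd[OF R(1)]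
          constant_on_chords_upd[OF R(2)] simp del: Union_iff\<close>)
  also have "\<dots> = colour_sum R2"
    unfolding colour_sum_def pts W_def ..
  finally show ?thesis
    by (simp add: sum_subtractf 1 R1_def R2_def)
qed

end

section \<open>The recursion along an arbitrary chord\<close>

lemma chord_cases:
  assumes "chord_diagram D" and "b \<in> D"
  obtains p q where "b = {p, q}" "p \<noteq> q"
  using assms by (auto simp: chord_diagram_def card_2_iff)

lemma chord_Min_Max:
  assumes "chord_diagram D" and "a \<in> D"
  shows "a = {Min a, Max a}" and "Min a < Max a"
proof -
  obtain p q where "a = {p, q}" "p \<noteq> q" by (rule chord_cases[OF assms])
  then show "a = {Min a, Max a}" "Min a < Max a"
    by (auto simp: min_def max_def)
qed

lemma crossing_chord:
  assumes "chord_diagram D" and "b \<in> crossing D a"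
  shows "b = {inner_end a b, outer_end a b}" and "inner_end a b \<in> side a" and "outer_end a b \<notin> side a"
    and "inner_end a b \<in> b" and "outer_end a b \<in> b"
proof -
  have b: "b \<in> D" "card (b \<inter> side a) = 1" using assms(2) by (auto simp: crossing_def)
  obtain p q where pq: "b = {p, q}" "p \<noteq> q" by (rule chord_cases[OF assms(1) b(1)])
  have "\<exists>p q. b = {p, q} \<and> p \<in> side a \<and> q \<notin> side a"
  proof (cases "p \<in> side a")
    case True
    then show ?thesis using b(2) pq by (cases "q \<in> side a") auto
  next
    case False
    then show ?thesis using b(2) pq by (cases "q \<in> side a") (auto simp: insert_commute)
  qed
  then obtain p q where *: "b = {p, q}" "p \<in> side a" "q \<notin> side a" by blast
  have "inner_end a b = p" unfolding inner_end_def by (rule the_equality) (use * in auto)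
  moreover have "outer_end a b = q" unfolding outer_end_def by (rule the_equality) (use * in auto)
  ultimately show "b = {inner_end a b, outer_end a b}" "inner_end a b \<in> side a"
    "outer_end a b \<notin> side a" "inner_end a b \<in> b" "outer_end a b \<in> b"
    using * by auto
qed

lemma resolve2_pair:
  assumes "b \<noteq> c"
  shows "resolve2 D a {b, c} = D - {a} - {b, c}
    \<union> {{inner_end a b, outer_end a c}, {inner_end a c, outer_end a b}}"
proof -
  have "{{inner_end a b', outer_end a c'} | b' c'. b' \<in> {b, c} \<and> c' \<in> {b, c} \<and> b' \<noteq> c'}
      = {{inner_end a b, outer_end a c}, {inner_end a c, outer_end a b}}"
    by (rule set_eqI) (use assms in auto)
  then show ?thesis unfolding resolve2_def by simp
qed

lemma self_not_crossing: "chord_diagram D \<Longrightarrow> a \<in> D \<Longrightarrow> a \<inter> side a = {}"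
  using chord_Min_Max(1)[of D a] unfolding side_def
  by (metis Int_emptyI greaterThanLessThan_iff insertE less_irrefl singletonD)

text \<open>
  The word of a diagram, cut at the two ends \<open>s\<close> and \<open>t\<close> of a chord.
\<close>

lemma sorted_list_of_set_split:
  assumes "finite P" and "s < t" and "s \<notin> P" and "t \<notin> P"
  defines "us \<equiv> sorted_list_of_set (P \<inter> {..<s})"
    and "qs \<equiv> sorted_list_of_set (P \<inter> {s<..<t})"
    and "vs \<equiv> sorted_list_of_set (P \<inter> {t<..})"
  shows "sorted_list_of_set P = us @ qs @ vs"
    and "sorted_list_of_set (insert s (insert t P)) = us @ s # qs @ t # (vs :: nat list)"
proof -
  have fin: "finite (P \<inter> A)" for A using assms(1) by simp
  have sorted: "sorted_wrt (<) xs \<Longrightarrow> set xs = A \<Longrightarrow> sorted_list_of_set A = xs"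
    for xs :: "nat list" and A
    by (metis distinct_card List.finite_set sorted_list_of_set_unique strict_sorted_iff)
  have mem: "set us = P \<inter> {..<s}" "set qs = P \<inter> {s<..<t}" "set vs = P \<inter> {t<..}"
    by (simp_all add: us_def qs_def vs_def fin)
  have strict: "sorted_wrt (<) us" "sorted_wrt (<) qs" "sorted_wrt (<) vs"
    by (simp_all add: us_def qs_def vs_def)
  have "x < s \<or> s < x \<and> x < t \<or> t < x" if "x \<in> P" for x
    using that assms(2-4) by (metis linorder_less_linear)
  then have "x \<in> set (us @ qs @ vs) \<longleftrightarrow> x \<in> P" for x
    by (cases "x \<in> P") (simp_all add: mem)
  then have P: "set (us @ qs @ vs) = P"
    by blast
  show "sorted_list_of_set P = us @ qs @ vs"
  proof (rule sorted[OF _ P])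
    show "sorted_wrt (<) (us @ qs @ vs)"
      using assms(2) strict by (auto simp: sorted_wrt_append mem)
  qed
  show "sorted_list_of_set (insert s (insert t P)) = us @ s # qs @ t # vs"
  proof (rule sorted)
    show "sorted_wrt (<) (us @ s # qs @ t # vs)"
      using assms(2) strict by (auto simp: sorted_wrt_append mem)
    show "set (us @ s # qs @ t # vs) = insert s (insert t P)"
      using P by auto
  qed
qed

context casimir_functional
begin

definition exchange_sum :: "chord set \<Rightarrow> nat \<Rightarrow> nat \<Rightarrow> complex" where
  "exchange_sum E p q = (let W = \<lambda>c. L (map c (sorted_list_of_set (\<Union>E))) in
     \<Sum>c\<in>colourings E. (if c p = c q then \<Sum>d\<in>UNIV. W (c(p := d, q := d)) else 0)
            - W (c(p := c q, q := c p)))"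

text \<open>
  The summation of \<open>contract_over_block\<close> over the colourings of the other chords; the
  crossings of \<open>a\<close> are not yet separated from the chords inside \<open>a\<close>.
\<close>

lemma colour_sum_remove_chord:
  assumes "chord_diagram D" and "a \<in> D"
  defines "E \<equiv> D - {a}" and "Q \<equiv> \<Union>(D - {a}) \<inter> side a"
  shows "2 * colour_sum D = 2 * (x - of_nat (card Q)) * colour_sum E
    + (\<Sum>p\<in>Q. \<Sum>q\<in>Q - {p}. exchange_sum E p q)"
proof -
  define P where "P = \<Union>E"
  define s where "s = Min a"
  define t where "t = Max a"
  have a: "a = {s, t}" "s < t"
    using chord_Min_Max[OF assms(1,2)] by (simp_all add: s_def t_def)
  have D: "D = insert {s, t} E" using assms(2) a by (auto simp: E_def)
  have E: "chord_diagram E" using assms(1) by (rule chord_diagram_subset) (auto simp: E_def)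
  have finP: "finite P" unfolding P_def by (rule chord_diagram_finite_points[OF E])
  have finE: "finite (colourings E)" unfolding P_def by (rule finite_colourings[OF finP[unfolded P_def]])
  have st: "s \<notin> P" "t \<notin> P"
    using chord_diagram_disjoint[OF assms(1,2)] a by (auto simp: P_def E_def)
  have Q: "Q = P \<inter> {s<..<t}" by (simp add: Q_def P_def E_def side_def s_def t_def)
  define us where "us = sorted_list_of_set (P \<inter> {..<s})"
  define qs where "qs = sorted_list_of_set Q"
  define vs where "vs = sorted_list_of_set (P \<inter> {t<..})"
  have split: "sorted_list_of_set (\<Union>E) = us @ qs @ vs"
    "sorted_list_of_set (\<Union>D) = us @ s # qs @ t # vs"
    using sorted_list_of_set_split[OF finP a(2) st]
    by (simp_all add: D P_def us_def qs_def vs_def Q[unfolded P_def])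
  have setqs: "set qs = Q" "distinct qs" using finP by (auto simp: qs_def Q)
  have ends: "s \<notin> set us" "t \<notin> set us" "s \<notin> set qs" "t \<notin> set qs" "s \<notin> set vs" "t \<notin> set vs"
    using st finP by (auto simp: us_def vs_def setqs Q)
  have outside: "p \<notin> set us" "p \<notin> set vs" if "p \<in> Q" for p
    using that finP a by (auto simp: us_def vs_def Q)
  have unmap: "map (c(p := d)) xs = map c xs" if "p \<notin> set xs" for c :: "nat \<Rightarrow> colour" and p d xs
    using that by auto
  have word: "map (c(s := d, t := d)) (us @ s # qs @ t # vs)
      = map c us @ d # map c qs @ d # map c vs" for c :: "nat \<Rightarrow> colour" and d
    using ends a(2) by auto
  have "colour_sum D = (\<Sum>(c, d)\<in>colourings E \<times> UNIV.
      L (map (c(s := d, t := d)) (us @ s # qs @ t # vs)))"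
    unfolding colour_sum_def split
  proof (rule sum.reindex_bij_witness[where i = "\<lambda>(c, d). c(s := d, t := d)"
        and j = "\<lambda>c. (c(s := undefined, t := undefined), c s)"], goal_cases)
    case (1 c)
    then have "c s = c t" by (simp add: D mem_colourings constant_on_chords_insert)
    then show ?case by auto
  next
    case (2 c)
    then show ?case
      using st by (auto simp: D mem_colourings constant_on_chords_insert P_def constant_on_chords_upd
          simp del: Union_iff)
  next
    case (3 cd)
    then show ?case
      using st a(2) by (auto simp: mem_colourings P_def fun_eq_iff simp del: Union_iff)
  next
    case (4 cd)
    then show ?case
      using st a(2) by (auto simp: D mem_colourings constant_on_chords_insert P_def constant_on_chords_upd
          simp del: Union_iff)
  next
    case (5 c)
    then have "c s = c t" by (simp add: D mem_colourings constant_on_chords_insert)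
    then have "c(s := undefined, t := undefined, s := c s, t := c s) = c" by auto
    then show ?case by (simp del: fun_upd_apply)
  qed
  also have "\<dots> = (\<Sum>c\<in>colourings E. \<Sum>d\<in>UNIV. L (map c us @ d # map c qs @ d # map c vs))"
    by (simp add: sum.cartesian_product[symmetric] word del: map_append list.map fun_upd_apply)
  finally have "2 * colour_sum D
      = (\<Sum>c\<in>colourings E. 2 * (\<Sum>d\<in>UNIV. L (map c us @ d # map c qs @ d # map c vs)))"
    by (simp add: sum_distrib_left)
  also have "\<dots> = (\<Sum>c\<in>colourings E. 2 * (x - of_nat (card Q)) * L (map c (us @ qs @ vs))
      + (\<Sum>p\<in>Q. \<Sum>q\<in>Q - {p}. exchange (map c us) (map c vs) qs c p q))"
    using contract_over_block[OF setqs(2)] distinct_card[OF setqs(2)] by (simp add: setqs)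
  also have "\<dots> = 2 * (x - of_nat (card Q)) * colour_sum E
      + (\<Sum>p\<in>Q. \<Sum>q\<in>Q - {p}. \<Sum>c\<in>colourings E. exchange (map c us) (map c vs) qs c p q)"
    unfolding colour_sum_def split sum.distrib sum_distrib_left
    by (subst sum.swap, subst (2) sum.swap) simp
  also have "(\<Sum>p\<in>Q. \<Sum>q\<in>Q - {p}. \<Sum>c\<in>colourings E. exchange (map c us) (map c vs) qs c p q)
      = (\<Sum>p\<in>Q. \<Sum>q\<in>Q - {p}. exchange_sum E p q)"
    unfolding exchange_sum_def Let_def exchange_def split
    by (intro sum.cong refl) (simp add: unmap outside del: fun_upd_apply)
  finally show ?thesis .
qed

text \<open>
  The colour sum satisfies the recursion of the weight along an arbitrary chord \<open>a\<close>. The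
  positions inside \<open>a\<close> are grouped by chords. Replacing \<open>p\<close> by the other end of its chord
  swaps the two resolutions, so the exchanges at the two ends of a chord that lies entirely
  inside \<open>a\<close> cancel against any position of another chord; such a chord only exchanges with
  itself, which makes up for the \<open>- 2\<close> that its two ends contribute. What remains are the
  pairs of chords that cross \<open>a\<close>.
\<close>

theorem colour_sum_recursion:
  assumes "chord_diagram D" and "a \<in> D"
  shows "colour_sum D = (x - of_nat (card (crossing D a))) * colour_sum (D - {a})
    + (\<Sum>S\<in>crossing_pairs D a. colour_sum (resolve1 D a S) - colour_sum (resolve2 D a S))"
proof -
  define E where "E = D - {a}"
  define Q where "Q = \<Union>E \<inter> side a"
  define H where "H = exchange_sum E"
  define G where "G S = colour_sum (resolve1 D a S) - colour_sum (resolve2 D a S)" for S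
  define C where "C = crossing D a"
  define I where "I = {b \<in> E. b \<subseteq> side a}"
  have E: "chord_diagram E" using assms(1) by (rule chord_diagram_subset) (auto simp: E_def)
  have finE: "finite E" using E by (simp add: chord_diagram_def)
  have CE: "C \<subseteq> E"
    using self_not_crossing[OF assms] by (auto simp: C_def crossing_def E_def)
  have finC: "finite C" using CE finE by (rule finite_subset)
  have finb: "finite b" if "b \<in> E" for b
    using that E by (auto simp: chord_diagram_def intro: card_ge_0_finite)
  have Q_sum: "(\<Sum>p\<in>Q. F p) = (\<Sum>b\<in>E. \<Sum>p\<in>b \<inter> side a. F p)"
    for F :: "nat \<Rightarrow> 'z::comm_monoid_add"
  proof -
    have Q: "Q = (\<Union>b\<in>E. b \<inter> side a)" by (auto simp: Q_def)
    moreover have "(b \<inter> side a) \<inter> (c \<inter> side a) = {}" if "b \<in> E" "c \<in> E" "b \<noteq> c" for b c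
      using that chord_diagram_disjoint[OF E] by blast
    ultimately show ?thesis
      unfolding Q using finE finb by (intro sum.UNION_disjoint) auto
  qed
  have kinds: "b \<inter> side a = {} \<and> b \<notin> C \<and> b \<notin> I \<or> b \<in> C \<and> b \<notin> I \<and> b \<inter> side a
      = {inner_end a b} \<or> b \<notin> C \<and> b \<in> I \<and> b \<inter> side a = b"
    if b: "b \<in> E" for b
  proof (cases "b \<in> C")
    case True
    then show ?thesis
      using crossing_chord[OF assms(1), of b a] by (auto simp: C_def I_def)
  next
    case False
    obtain p q where pq: "b = {p, q}" "p \<noteq> q" by (rule chord_cases[OF E b])
    have "b \<in> D" using b by (simp add: E_def)
    then have "card (b \<inter> side a) \<noteq> 1" using False by (simp add: C_def crossing_def)
    then show ?thesis using False pq b by (cases "p \<in> side a"; cases "q \<in> side a") (auto simp: I_def)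
  qed
  define h where "h b c = (\<Sum>p\<in>b \<inter> side a. \<Sum>q\<in>c \<inter> side a. if q = p then 0 else H p q)" for b c
  have cardQ: "card Q = card C + 2 * card I"
  proof -
    have "card Q = (\<Sum>b\<in>E. card (b \<inter> side a))"
      using Q_sum[of "\<lambda>_. 1::nat"] by simp
    also have "\<dots> = (\<Sum>b\<in>E. (if b \<in> C then 1 else 0) + 2 * (if b \<in> I then 1 else 0))"
      using kinds E by (intro sum.cong refl) (fastforce simp: chord_diagram_def)
    also have "\<dots> = card C + 2 * card I"
      using finE CE by (simp add: sum.distrib sum_distrib_left[symmetric] sum.inter_restrict[symmetric]
          I_def Int_absorb1 flip: sum.inter_filter)
    finally show ?thesis .
  qed
  have diag: "h b b = (if b \<in> I then 4 * colour_sum E else 0)" if b: "b \<in> E" for b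
  proof -
    obtain p q where pq: "b = {p, q}" "p \<noteq> q" by (rule chord_cases[OF E b])
    have "H p q = 2 * colour_sum E" "H q p = 2 * colour_sum E"
      using colour_sum_exchange_same[OF E, of p q] colour_sum_exchange_same[OF E, of q p] b pq
      by (simp_all add: H_def exchange_sum_def Let_def insert_commute)
    then show ?thesis
      using kinds[OF b] pq by (auto simp: h_def)
  qed
  have offdiag: "h b c = (if b \<in> C \<and> c \<in> C then G {b, c} else 0)"
    if bc: "b \<in> E" "c \<in> E" "b \<noteq> c" for b c
  proof -
    have disj: "p \<noteq> q" if "p \<in> b" "q \<in> c" for p q
      using that bc chord_diagram_disjoint[OF E bc(1,2)] by auto
    then have h: "h b c = (\<Sum>p\<in>b \<inter> side a. \<Sum>q\<in>c \<inter> side a. H p q)"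
      unfolding h_def by (intro sum.cong refl) auto
    have H: "H p q = colour_sum (E - {b, c} \<union> {{p, q}, {p', q'}})
          - colour_sum (E - {b, c} \<union> {{p, q'}, {q, p'}})"
      if "b = {p, p'}" "c = {q, q'}" "p \<noteq> p'" "q \<noteq> q'" for p p' q q'
      using colour_sum_exchange_distinct[OF E, of p p' q q'] that bc
      by (simp add: H_def exchange_sum_def Let_def)
    obtain p p' where b: "b = {p, p'}" "p \<noteq> p'" by (rule chord_cases[OF E bc(1)])
    obtain q q' where c: "c = {q, q'}" "q \<noteq> q'" by (rule chord_cases[OF E bc(2)])
    have b': "b = {p', p}" and c': "c = {q', q}" using b c by auto
    have left: "H p r + H p' r = 0" if "r \<in> c" for r
    proof -
      consider "r = q" | "r = q'" using \<open>r \<in> c\<close> c(1) by blast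
      then show ?thesis
        using H[OF b(1) c(1) b(2) c(2)] H[OF b' c(1) b(2)[symmetric] c(2)]
          H[OF b(1) c' b(2) c(2)[symmetric]] H[OF b' c' b(2)[symmetric] c(2)[symmetric]]
        by cases (simp_all add: insert_commute)
    qed
    have right: "H r q + H r q' = 0" if "r \<in> b" for r
    proof -
      consider "r = p" | "r = p'" using \<open>r \<in> b\<close> b(1) by blast
      then show ?thesis
        using H[OF b(1) c(1) b(2) c(2)] H[OF b' c(1) b(2)[symmetric] c(2)]
          H[OF b(1) c' b(2) c(2)[symmetric]] H[OF b' c' b(2)[symmetric] c(2)[symmetric]]
        by cases (simp_all add: insert_commute)
    qed
    show ?thesis
    proof (cases "b \<in> C \<and> c \<in> C")
      case True
      let ?i = "inner_end a" and ?o = "outer_end a"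
      have bi: "b = {?i b, ?o b}" "?i b \<in> side a" "?o b \<notin> side a"
        using crossing_chord[OF assms(1), of b a] True by (auto simp: C_def)
      have ci: "c = {?i c, ?o c}" "?i c \<in> side a" "?o c \<notin> side a"
        using crossing_chord[OF assms(1), of c a] True by (auto simp: C_def)
      have ne: "?i b \<noteq> ?o b" "?i c \<noteq> ?o c" using bi(2,3) ci(2,3) by metis+
      have "h b c = H (?i b) (?i c)"
        using kinds[OF bc(1)] kinds[OF bc(2)] True by (auto simp: h)
      moreover have "resolve1 D a {b, c} = E - {b, c} \<union> {{?i b, ?i c}, {?o b, ?o c}}"
        by (simp add: resolve1_def E_def)
      moreover have "resolve2 D a {b, c} = E - {b, c} \<union> {{?i b, ?o c}, {?i c, ?o b}}"
        unfolding E_def by (rule resolve2_pair[OF bc(3)])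
      ultimately show ?thesis
        using H[OF bi(1) ci(1) ne] True by (simp add: G_def)
    next
      case False
      then consider "b \<inter> side a = {}" | "c \<inter> side a = {}" | "b \<inter> side a = b" | "c \<inter> side a = c"
        using kinds[OF bc(1)] kinds[OF bc(2)] by blast
      then have "h b c = 0"
      proof cases
        case 3
        have "h b c = (\<Sum>r\<in>c \<inter> side a. H p r + H p' r)"
          unfolding h 3 using b by (simp add: sum.distrib)
        then show ?thesis using left by simp
      next
        case 4
        have "h b c = (\<Sum>r\<in>b \<inter> side a. H r q + H r q')"
          unfolding h 4 using c by simp
        then show ?thesis using right by simp
      qed (simp_all add: h)
      then show ?thesis using False by auto
    qed
  qed
  have "(\<Sum>p\<in>Q. \<Sum>q\<in>Q - {p}. H p q) = (\<Sum>p\<in>Q. \<Sum>q\<in>Q. if q = p then 0 else H p q)"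
  proof (rule sum.cong[OF refl])
    fix p assume "p \<in> Q"
    have "finite Q" using chord_diagram_finite_points[OF E] by (simp add: Q_def)
    then show "(\<Sum>q\<in>Q - {p}. H p q) = (\<Sum>q\<in>Q. if q = p then 0 else H p q)"
      by (intro sum.mono_neutral_cong_left) auto
  qed
  also have "\<dots> = (\<Sum>b\<in>E. \<Sum>c\<in>E. h b c)"
    unfolding Q_sum h_def by (intro sum.cong refl) (rule sum.swap)
  also have "\<dots> = (\<Sum>b\<in>E. h b b + (\<Sum>c\<in>E - {b}. h b c))"
    using finE by (intro sum.cong refl sum.remove)
  also have "\<dots> = (\<Sum>b\<in>E. if b \<in> I then 4 * colour_sum E else 0)
      + (\<Sum>b\<in>E. \<Sum>c\<in>E - {b}. if b \<in> C \<and> c \<in> C then G {b, c} else 0)"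
    unfolding sum.distrib
    by (intro arg_cong2[where f = "(+)"] sum.cong refl) (use diag in blast, use offdiag in blast)
  also have "(\<Sum>b\<in>E. if b \<in> I then 4 * colour_sum E else 0) = 4 * of_nat (card I) * colour_sum E"
    using finE by (simp add: I_def flip: sum.inter_filter)
  also have "(\<Sum>b\<in>E. \<Sum>c\<in>E - {b}. if b \<in> C \<and> c \<in> C then G {b, c} else 0)
      = (\<Sum>b\<in>C. \<Sum>c\<in>C - {b}. G {b, c})"
  proof -
    have "(\<Sum>c\<in>E - {b}. if b \<in> C \<and> c \<in> C then G {b, c} else 0)
        = (if b \<in> C then \<Sum>c\<in>C - {b}. G {b, c} else 0)" for b
      using finE CE by (auto intro!: sum.mono_neutral_cong_right)
    then show ?thesis
      using finE CE by (auto intro!: sum.mono_neutral_cong_right)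
  qed
  also have "\<dots> = 2 * (\<Sum>S\<in>crossing_pairs D a. G S)"
    using sum_unordered_pairs[OF finC, of G] by (simp add: crossing_pairs_def C_def)
  finally have "2 * colour_sum D = 2 * (x - of_nat (card Q)) * colour_sum E
      + (4 * of_nat (card I) * colour_sum E + 2 * (\<Sum>S\<in>crossing_pairs D a. G S))"
    using colour_sum_remove_chord[OF assms] by (simp add: E_def[symmetric] Q_def[symmetric] H_def)
  then have "2 * colour_sum D = 2 * ((x - of_nat (card C)) * colour_sum E
      + (\<Sum>S\<in>crossing_pairs D a. G S))"
    by (simp add: cardQ algebra_simps)
  then have "colour_sum D = (x - of_nat (card C)) * colour_sum E + (\<Sum>S\<in>crossing_pairs D a. G S)"
    by (subst (asm) mult_cancel_left) simp
  then show ?thesis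
    by (simp add: G_def E_def C_def)
qed

end

section \<open>The weight is well defined\<close>

lemma chord_diagram_insert:
  assumes "chord_diagram R" and "p \<noteq> q" and "p \<notin> \<Union>R" and "q \<notin> \<Union>R"
  shows "chord_diagram (insert {p, q} R) \<and> card (insert {p, q} R) = Suc (card R)"
proof
  have "{p, q} \<inter> b = {}" if "b \<in> R" for b using assms(3,4) that by blast
  then show "chord_diagram (insert {p, q} R)"
    using assms(1,2) unfolding chord_diagram_def by (simp add: Int_commute)
  have "{p, q} \<notin> R" using assms(3) by blast
  then show "card (insert {p, q} R) = Suc (card R)"
    using assms(1) by (simp add: chord_diagram_def)
qed

lemma resolve_chord_diagram:
  assumes "chord_diagram D" and "a \<in> D" and "S \<in> crossing_pairs D a"
  shows "chord_diagram (resolve1 D a S) \<and> card (resolve1 D a S) = card D - 1"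
    and "chord_diagram (resolve2 D a S) \<and> card (resolve2 D a S) = card D - 1"
proof -
  obtain b c where S: "S = {b, c}" "b \<noteq> c" and bc: "b \<in> crossing D a" "c \<in> crossing D a"
    using assms(3) by (auto simp: crossing_pairs_def card_2_iff)
  define R where "R = D - {a} - S"
  let ?i = "inner_end a" and ?o = "outer_end a"
  note b = crossing_chord[OF assms(1) bc(1)] and c = crossing_chord[OF assms(1) bc(2)]
  have D: "b \<in> D" "c \<in> D" using bc by (auto simp: crossing_def)
  have "a \<noteq> b" "a \<noteq> c"
    using self_not_crossing[OF assms(1,2)] bc by (auto simp: crossing_def)
  then have "card (D - {a} - S) = card D - 3"
    using assms(1,2) D S(2) unfolding S by (simp add: chord_diagram_def card_Diff_subset)
  moreover have "card D \<ge> 3"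
    using card_mono[of D "{a, b, c}"] \<open>a \<noteq> b\<close> \<open>a \<noteq> c\<close> assms(1,2) D S(2) by (simp add: chord_diagram_def)
  ultimately have cardR: "card R + 2 = card D - 1" by (simp add: R_def)
  have R: "chord_diagram R" using assms(1) by (rule chord_diagram_subset) (auto simp: R_def)
  have notR: "p \<notin> \<Union>R" if p: "p \<in> b \<or> p \<in> c" for p
  proof
    assume "p \<in> \<Union>R"
    then obtain e where e: "e \<in> D" "p \<in> e" "e \<noteq> b" "e \<noteq> c" by (auto simp: R_def S)
    then show False
      using p chord_diagram_disjoint[OF assms(1) D(1) e(1)] chord_diagram_disjoint[OF assms(1) D(2) e(1)]
      by metis
  qed
  have disj: "p \<noteq> q" if "p \<in> b" "q \<in> c" for p q
    using that S(2) chord_diagram_disjoint[OF assms(1) D] by auto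
  note ends = b(4,5) c(4,5)
  have dist: "?i b \<noteq> ?i c" "?i b \<noteq> ?o c" "?o b \<noteq> ?i c" "?o b \<noteq> ?o c"
    by (intro disj ends)+
  have dist': "?i b \<noteq> ?o b" "?i c \<noteq> ?o c"
    using b(2,3) c(2,3) by metis+
  have add: "chord_diagram (R \<union> {{p, q}, {r, s}}) \<and> card (R \<union> {{p, q}, {r, s}}) = card D - 1"
    if "p \<notin> \<Union>R" "q \<notin> \<Union>R" "r \<notin> \<Union>R" "s \<notin> \<Union>R" "distinct [p, q, r, s]" for p q r s
  proof (rule conjI)
    have "chord_diagram (insert {r, s} R) \<and> card (insert {r, s} R) = Suc (card R)"
      by (rule chord_diagram_insert) (use R that in auto)
    then have *: "chord_diagram (insert {p, q} (insert {r, s} R))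
        \<and> card (insert {p, q} (insert {r, s} R)) = Suc (Suc (card R))"
      using chord_diagram_insert[of "insert {r, s} R" p q] that by simp
    have eq: "R \<union> {{p, q}, {r, s}} = insert {p, q} (insert {r, s} R)" by blast
    show "chord_diagram (R \<union> {{p, q}, {r, s}})" "card (R \<union> {{p, q}, {r, s}}) = card D - 1"
      using * cardR unfolding eq by simp_all
  qed
  have outside: "?i b \<notin> \<Union>R" "?o b \<notin> \<Union>R" "?i c \<notin> \<Union>R" "?o c \<notin> \<Union>R"
    by (intro notR disjI1 ends, intro notR disjI1 ends, intro notR disjI2 ends, intro notR disjI2 ends)
  have r1: "resolve1 D a S = R \<union> {{?i b, ?i c}, {?o b, ?o c}}"
    by (simp add: resolve1_def R_def S)
  show "chord_diagram (resolve1 D a S) \<and> card (resolve1 D a S) = card D - 1"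
    unfolding r1 using dist dist' by (intro add outside) auto
  have r2: "resolve2 D a S = R \<union> {{?i b, ?o c}, {?i c, ?o b}}"
    unfolding R_def S by (rule resolve2_pair[OF S(2)])
  show "chord_diagram (resolve2 D a S) \<and> card (resolve2 D a S) = card D - 1"
    unfolding r2 using dist dist' by (intro add outside) auto
qed

text \<open>
  Every step of the recursion removes one chord.
\<close>

lemma weight_exists:
  assumes "chord_diagram D" and "D \<noteq> {}"
  shows "\<exists>p. weight D p"
  using assms
proof (induction "card D" arbitrary: D rule: less_induct)
  case less
  have fin: "finite D" using less.prems by (simp add: chord_diagram_def)
  show ?case
  proof (cases "card D = 1")
    case True
    then show ?thesis using less.prems one_chord by blast
  next
    case False
    then have card: "card D \<ge> 2" using less.prems fin
        by (metis One_nat_def Suc_1 Suc_leI card_gt_0_iff le_neq_implies_less)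
    obtain a where a: "a \<in> D" using less.prems by auto
    have step: "\<exists>p. weight E p" if "chord_diagram E \<and> card E = card D - 1" for E
    proof -
      have "E \<noteq> {}" "card E < card D" using that card by auto
      then show ?thesis using less.hyps that by blast
    qed
    obtain p where p: "weight (D - {a}) p"
      using step[of "D - {a}"] chord_diagram_subset[OF less.prems(1), of "D - {a}"] a fin by auto
    have "\<forall>S\<in>crossing_pairs D a. \<exists>q. weight (resolve1 D a S) q"
      "\<forall>S\<in>crossing_pairs D a. \<exists>q. weight (resolve2 D a S) q"
      using resolve_chord_diagram[OF less.prems(1) a] step by blast+
    then obtain f g where "\<forall>S\<in>crossing_pairs D a. weight (resolve1 D a S) (f S)"
      "\<forall>S\<in>crossing_pairs D a. weight (resolve2 D a S) (g S)"
      by metis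
    then show ?thesis
      using weight.step[OF less.prems(1) card a p, of f g] by blast
  qed
qed

lemma (in casimir_functional) colour_sum_empty: "colour_sum {} = 1"
  by (simp add: colour_sum_def colourings_def constant_on_chords_def L_Nil)

lemma (in casimir_functional) colour_sum_one_chord:
  assumes "chord_diagram D" and "card D = 1"
  shows "colour_sum D = x"
proof -
  obtain a where a: "D = {a}" using assms(2) by (auto simp: card_1_singleton_iff)
  then have "crossing D a = {}"
    using self_not_crossing[OF assms(1)] by (auto simp: crossing_def)
  moreover from this have "crossing_pairs D a = {}" by (auto simp: crossing_pairs_def)
  ultimately show ?thesis
    using colour_sum_recursion[OF assms(1), of a] a by (simp add: colour_sum_empty)
qed

lemma weight_eval:
  assumes "casimir_functional L (of_int x)" and "weight D p"
  shows "of_int (poly p x) = casimir_functional.colour_sum L D"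
proof -
  interpret casimir_functional L "of_int x" by fact
  show ?thesis
    using assms(2)
  proof (induction rule: weight.induct)
    case (one_chord D)
    then show ?case by (simp add: colour_sum_one_chord)
  next
    case (step D a p f g)
    then show ?case
      by (simp add: colour_sum_recursion[OF step.hyps(1,3)] poly_sum)
  qed
qed

text \<open>
  Two weights of one diagram agree at all integers, since both compute the colour sum there.
\<close>

theorem weight_unique:
  assumes "weight D p" and "weight D q"
  shows "p = q"
proof -
  have "poly p x = poly q x" for x :: int
    using weight_eval[OF spin_word_functional assms(1), of x]
      weight_eval[OF spin_word_functional assms(2), of x] by (metis of_int_eq_iff)
  then show ?thesis by (simp add: poly_eq_poly_eq_iff[symmetric] fun_eq_iff)
qed

lemma phi_eval:
  assumes "casimir_functional L (of_int x)" and "chord_diagram D" and "D \<noteq> {}"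
  shows "of_int (poly (phi D) x) = casimir_functional.colour_sum L D"
proof -
  obtain p where p: "weight D p" using weight_exists[OF assms(2,3)] ..
  then have "phi D = p" unfolding phi_def using weight_unique by blast
  then show ?thesis using weight_eval[OF assms(1) p] by simp
qed

section \<open>Identities for trivalent vertices\<close>

context casimir_functional
begin

lemma bracket_sum:
  "L (u @ a # b # v) - L (u @ b # a # v) = (\<Sum>c\<in>UNIV. eps a b c * L (u @ c # v))"
  using bracket[of u a b v] by simp

text \<open>
  The vector triple product \<open>[[s, a], b] = \<langle>a, b\<rangle> s - \<langle>s, b\<rangle> a\<close>.
\<close>

lemma double_bracket:
  "(\<Sum>c\<in>UNIV. \<Sum>d\<in>UNIV. eps s a c * eps c b d * L (u @ d # v))
     = (if a = b then L (u @ s # v) else 0) - (if s = b then L (u @ a # v) else 0)"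
proof -
  have r: "eps s a c = eps c s a" for c by (metis eps_rotate)
  have "(\<Sum>c\<in>UNIV. \<Sum>d\<in>UNIV. eps s a c * eps c b d * L (u @ d # v))
      = (\<Sum>d\<in>UNIV. (\<Sum>c\<in>UNIV. eps c s a * eps c b d) * L (u @ d # v))"
    unfolding sum_distrib_right r by (rule sum.swap)
  then show ?thesis
    unfolding eps_contract by (cases s; cases a; cases b) (simp_all add: sum_colour)
qed

lemma two_brackets:
  fixes F :: "colour \<Rightarrow> colour \<Rightarrow> complex"
  shows "(\<Sum>a\<in>UNIV. \<Sum>c\<in>UNIV. \<Sum>d\<in>UNIV. eps s a c * eps a b d * F c d)
     = (if s = b then \<Sum>c\<in>UNIV. F c c else 0) - F b s"
proof -
  have "(\<Sum>a\<in>UNIV. \<Sum>c\<in>UNIV. \<Sum>d\<in>UNIV. eps s a c * eps a b d * F c d)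
      = (\<Sum>a\<in>UNIV. \<Sum>c\<in>UNIV. \<Sum>d\<in>UNIV. eps a c s * eps a b d * F c d)"
    by (intro sum.cong refl) (metis eps_rotate)
  also have "\<dots> = (\<Sum>c\<in>UNIV. \<Sum>a\<in>UNIV. \<Sum>d\<in>UNIV. eps a c s * eps a b d * F c d)"
    by (rule sum.swap)
  also have "\<dots> = (\<Sum>c\<in>UNIV. \<Sum>d\<in>UNIV. (\<Sum>a\<in>UNIV. eps a c s * eps a b d) * F c d)"
    unfolding sum_distrib_right by (intro sum.cong refl sum.swap)
  finally show ?thesis
    unfolding eps_contract by (cases s; cases b) (simp_all add: sum_colour)
qed

text \<open>
  The effect of carrying the end of a chord \<open>s\<close> past the adjacent ends of two parallel
  chords \<open>a\<close> and \<open>b\<close>, at second order. The two first differences are brackets of \<open>s\<close> with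
  \<open>a\<close> and with \<open>b\<close>; up to renaming they differ only in the order of \<open>a\<close> and \<open>b\<close> at both of
  their ends, so their difference is a sum of double brackets, which resolve into chords.
\<close>

lemma second_difference:
  "(\<Sum>s\<in>UNIV. \<Sum>a\<in>UNIV. \<Sum>b\<in>UNIV. L (s # U @ s # a # b # V @ a # b # Z)
        - 2 * L (s # U @ a # s # b # V @ a # b # Z) + L (s # U @ a # b # s # V @ a # b # Z))
    = x * (\<Sum>s\<in>UNIV. L (s # U @ s # V @ Z)) - (\<Sum>s\<in>UNIV. \<Sum>a\<in>UNIV. L (s # U @ a # V @ a # s # Z))
      + (\<Sum>s\<in>UNIV. \<Sum>a\<in>UNIV. L (s # U @ s # a # V @ a # Z)) - x * (\<Sum>s\<in>UNIV. L (s # U @ V @ s # Z))"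
proof -
  define D1 where "D1 s a b = L (s # U @ s # a # b # V @ a # b # Z)
      - L (s # U @ a # s # b # V @ a # b # Z)" for s a b
  define D2 where "D2 s a b = L (s # U @ a # s # b # V @ a # b # Z)
      - L (s # U @ a # b # s # V @ a # b # Z)" for s a b
  have D1: "D1 s a b = (\<Sum>c\<in>UNIV. eps s a c * L (s # U @ c # b # V @ a # b # Z))" for s a b
    unfolding D1_def using bracket_sum[of "s # U" s a "b # V @ a # b # Z"] by simp
  have D2: "D2 s b a = (\<Sum>c\<in>UNIV. eps s a c * L (s # U @ b # c # V @ b # a # Z))" for s a b
    unfolding D2_def using bracket_sum[of "s # U @ [b]" s a "V @ b # a # Z"] by simp
  have diff: "D1 s a b - D2 s b a
      = (\<Sum>c\<in>UNIV. \<Sum>d\<in>UNIV. eps s a c * eps c b d * L (s # U @ d # V @ a # b # Z))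
        + (\<Sum>c\<in>UNIV. \<Sum>d\<in>UNIV. eps s a c * eps a b d * L (s # U @ b # c # V @ d # Z))" for s a b
  proof -
    have "D1 s a b - D2 s b a = (\<Sum>c\<in>UNIV. eps s a c * (L (s # U @ c # b # V @ a # b # Z)
        - L (s # U @ b # c # V @ b # a # Z)))"
      unfolding D1 D2 by (simp add: sum_subtractf right_diff_distrib)
    also have "\<dots> = (\<Sum>c\<in>UNIV. eps s a c * ((\<Sum>d\<in>UNIV. eps c b d * L (s # U @ d # V @ a # b # Z))
        + (\<Sum>d\<in>UNIV. eps a b d * L (s # U @ b # c # V @ d # Z))))"
    proof (intro sum.cong refl arg_cong[where f = "\<lambda>y. _ * y"])
      fix c
      have e1: "L (s # U @ c # b # V @ a # b # Z) = L (s # U @ b # c # V @ a # b # Z)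
          + (\<Sum>d\<in>UNIV. eps c b d * L (s # U @ d # V @ a # b # Z))"
        using bracket[of "s # U" c b "V @ a # b # Z"] by simp
      have e2: "L (s # U @ b # c # V @ a # b # Z) = L (s # U @ b # c # V @ b # a # Z)
          + (\<Sum>d\<in>UNIV. eps a b d * L (s # U @ b # c # V @ d # Z))"
        using bracket[of "s # U @ b # c # V" a b Z] by simp
      show "L (s # U @ c # b # V @ a # b # Z) - L (s # U @ b # c # V @ b # a # Z)
        = (\<Sum>d\<in>UNIV. eps c b d * L (s # U @ d # V @ a # b # Z))
          + (\<Sum>d\<in>UNIV. eps a b d * L (s # U @ b # c # V @ d # Z))"
        by (subst e1, subst e2) simp
    qed
    finally show ?thesis by (simp add: distrib_left sum.distrib sum_distrib_left mult.assoc)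
  qed
  have first: "(\<Sum>a\<in>UNIV. \<Sum>b\<in>UNIV. \<Sum>c\<in>UNIV. \<Sum>d\<in>UNIV.
        eps s a c * eps c b d * L (s # U @ d # V @ a # b # Z))
      = x * L (s # U @ s # V @ Z) - (\<Sum>a\<in>UNIV. L (s # U @ a # V @ a # s # Z))" for s
  proof -
    have "(\<Sum>b\<in>UNIV. \<Sum>c\<in>UNIV. \<Sum>d\<in>UNIV. eps s a c * eps c b d * L (s # U @ d # V @ a # b # Z))
      = L (s # U @ s # V @ a # a # Z) - L (s # U @ a # V @ a # s # Z)" for a
      using double_bracket[of s a _ "s # U" "V @ a # _ # Z"] by (simp add: sum_subtractf)
    then show ?thesis
      using casimir[of "s # U @ s # V" Z] by (simp add: sum_subtractf)
  qed
  have second: "(\<Sum>a\<in>UNIV. \<Sum>b\<in>UNIV. \<Sum>c\<in>UNIV. \<Sum>d\<in>UNIV.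
        eps s a c * eps a b d * L (s # U @ b # c # V @ d # Z))
      = (\<Sum>a\<in>UNIV. L (s # U @ s # a # V @ a # Z)) - x * L (s # U @ V @ s # Z)" for s
    using casimir[of "s # U" "V @ s # Z"]
    by (subst sum.swap) (simp add: two_brackets sum_subtractf)
  have telescope: "y - z - (z - w) = y - 2 * z + w" for y z w :: complex by simp
  have "(\<Sum>s\<in>UNIV. \<Sum>a\<in>UNIV. \<Sum>b\<in>UNIV. D1 s a b - D2 s a b)
      = (\<Sum>s\<in>UNIV. \<Sum>a\<in>UNIV. \<Sum>b\<in>UNIV. D1 s a b - D2 s b a)"
    unfolding sum_subtractf by (intro arg_cong2[where f = minus] refl sum.cong sum.swap)
  also have "\<dots> = x * (\<Sum>s\<in>UNIV. L (s # U @ s # V @ Z)) - (\<Sum>s\<in>UNIV. \<Sum>a\<in>UNIV. L (s # U @ a # V @ a # s # Z))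
      + ((\<Sum>s\<in>UNIV. \<Sum>a\<in>UNIV. L (s # U @ s # a # V @ a # Z)) - x * (\<Sum>s\<in>UNIV. L (s # U @ V @ s # Z)))"
    unfolding diff sum.distrib first second by (simp add: sum_subtractf sum_distrib_left)
  finally show ?thesis
    unfolding D1_def D2_def by (simp only: telescope add_diff_eq)
qed

text \<open>
  A trivalent vertex with two legs at the ends of a removed chord \<open>a\<close> and the third leg at
  \<open>s\<close>: the bracket may be taken at either end of \<open>a\<close>, since the structure constants are
  invariant under cyclic permutations.
\<close>

lemma tripod_symmetry:
  "(\<Sum>s\<in>UNIV. \<Sum>a\<in>UNIV. L (s # U @ s # a # V @ a # Z) - L (s # U @ a # s # V @ a # Z))
    = (\<Sum>s\<in>UNIV. \<Sum>a\<in>UNIV. L (s # U @ a # V @ a # s # Z) - L (s # U @ a # V @ s # a # Z))"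
proof -
  have 1: "L (s # U @ s # a # V @ a # Z) - L (s # U @ a # s # V @ a # Z)
      = (\<Sum>c\<in>UNIV. eps s a c * L (s # U @ c # V @ a # Z))" for s a
    using bracket_sum[of "s # U" s a "V @ a # Z"] by simp
  have 2: "L (s # U @ a # V @ a # s # Z) - L (s # U @ a # V @ s # a # Z)
      = (\<Sum>c\<in>UNIV. eps s c a * L (s # U @ a # V @ c # Z))" for s a
    using bracket_sum[of "s # U @ a # V" a s Z] by (simp add: eps_rotate)
  show ?thesis
    unfolding 1 2 by (intro sum.cong refl sum.swap)
qed

text \<open>
  A trivalent vertex as in \<open>tripod_symmetry\<close> whose third leg is in turn bracketed with the
  end of a chord \<open>h\<close>. The two vertices form a tree with four legs, which equals a difference
  of two pairs of chords.
\<close>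

lemma bracketed_crossing:
  "(\<Sum>h\<in>UNIV. \<Sum>s\<in>UNIV. \<Sum>a\<in>UNIV.
        (L (h # s # U @ s # a # V @ h # W @ a # Z) - L (h # s # U @ a # s # V @ h # W @ a # Z))
        - (L (s # h # U @ s # a # V @ h # W @ a # Z) - L (s # h # U @ a # s # V @ h # W @ a # Z)))
    = (\<Sum>h\<in>UNIV. \<Sum>s\<in>UNIV. L (s # U @ s # V @ h # W @ h # Z))
      - (\<Sum>h\<in>UNIV. \<Sum>s\<in>UNIV. L (s # U @ h # V @ h # W @ s # Z))"
proof -
  have bracketed: "(L (h # s # U @ s # a # V @ h # W @ a # Z) - L (h # s # U @ a # s # V @ h # W @ a # Z))
        - (L (s # h # U @ s # a # V @ h # W @ a # Z) - L (s # h # U @ a # s # V @ h # W @ a # Z))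
      = (\<Sum>d\<in>UNIV. \<Sum>c\<in>UNIV. eps h s d * eps s a c * L (d # U @ c # V @ h # W @ a # Z))" for h s a
  proof -
    have right: "L (u @ s # a # V @ h # W @ a # Z) - L (u @ a # s # V @ h # W @ a # Z)
        = (\<Sum>c\<in>UNIV. eps s a c * L (u @ c # V @ h # W @ a # Z))" for u
      by (rule bracket_sum)
    have left: "L (h # s # U @ c # V @ h # W @ a # Z) - L (s # h # U @ c # V @ h # W @ a # Z)
        = (\<Sum>d\<in>UNIV. eps h s d * L (d # U @ c # V @ h # W @ a # Z))" for c
      using bracket_sum[of "[]" h s "U @ c # V @ h # W @ a # Z"] by simp
    have "(L (h # s # U @ s # a # V @ h # W @ a # Z) - L (h # s # U @ a # s # V @ h # W @ a # Z))
        - (L (s # h # U @ s # a # V @ h # W @ a # Z) - L (s # h # U @ a # s # V @ h # W @ a # Z))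
      = (\<Sum>c\<in>UNIV. eps s a c * L (h # s # U @ c # V @ h # W @ a # Z))
        - (\<Sum>c\<in>UNIV. eps s a c * L (s # h # U @ c # V @ h # W @ a # Z))"
      using right[of "h # s # U"] right[of "s # h # U"] by simp
    also have "\<dots> = (\<Sum>c\<in>UNIV. eps s a c * (\<Sum>d\<in>UNIV. eps h s d * L (d # U @ c # V @ h # W @ a # Z)))"
      unfolding sum_subtractf[symmetric] right_diff_distrib[symmetric] left ..
    also have "\<dots> = (\<Sum>d\<in>UNIV. \<Sum>c\<in>UNIV. eps h s d * eps s a c * L (d # U @ c # V @ h # W @ a # Z))"
      unfolding sum_distrib_left by (subst sum.swap) (simp add: ac_simps)
    finally show ?thesis .
  qed
  have "(\<Sum>s\<in>UNIV. \<Sum>a\<in>UNIV. \<Sum>d\<in>UNIV. \<Sum>c\<in>UNIV.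
          eps h s d * eps s a c * L (d # U @ c # V @ h # W @ a # Z))
      = (\<Sum>s\<in>UNIV. L (s # U @ s # V @ h # W @ h # Z)) - (\<Sum>s\<in>UNIV. L (s # U @ h # V @ h # W @ s # Z))"
    for h
    by (subst sum.swap) (simp add: two_brackets sum_subtractf)
  then show ?thesis
    unfolding bracketed by (simp add: sum_subtractf)
qed

text \<open>
  A chord that crosses exactly one other chord contributes the factor \<open>x - 1\<close>.
\<close>

lemma isolated_crossing:
  "(\<Sum>s\<in>UNIV. \<Sum>a\<in>UNIV. L (s # a # s # V @ a # Z)) = (x - 1) * (\<Sum>a\<in>UNIV. L (a # V @ a # Z))"
proof -
  have "(\<Sum>s\<in>UNIV. L (s # a # s # V @ a # Z)) = (x - 1) * L (a # V @ a # Z)" for a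
  proof -
    have "(\<Sum>s\<in>UNIV. L (s # a # s # V @ a # Z)) = (\<Sum>s\<in>UNIV. L (a # s # s # V @ a # Z)
        + (\<Sum>c\<in>UNIV. eps s a c * L (c # s # V @ a # Z)))"
      using bracket[of "[]" _ a "_ # V @ a # Z"] by (intro sum.cong refl) fastforce
    also have "\<dots> = x * L (a # V @ a # Z) - L (a # V @ a # Z)"
      using bracket_contracted[of a "[]" "V @ a # Z"] casimir[of "[a]" "V @ a # Z"]
      by (simp add: sum.distrib)
    finally show ?thesis by (simp add: algebra_simps)
  qed
  then show ?thesis
    by (subst sum.swap) (simp add: sum_distrib_left)
qed

end

section \<open>Words and rotation\<close>

definition words :: "nat \<Rightarrow> colour list set" where
  "words k = {w. length w = k}"

lemma sum_words_add:
  "(\<Sum>w\<in>words (j + k). F w) = (\<Sum>u\<in>words j. \<Sum>v\<in>words k. F (u @ v))"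
  for F :: "colour list \<Rightarrow> 'a::comm_monoid_add"
  unfolding sum.cartesian_product
  by (rule sum.reindex_bij_witness[where i = "\<lambda>(u, v). u @ v" and j = "\<lambda>w. (take j w, drop j w)"])
    (auto simp: words_def)

lemma sum_words_0: "(\<Sum>w\<in>words 0. F w) = F []"
  for F :: "colour list \<Rightarrow> 'a::comm_monoid_add"
  by (simp add: words_def)

lemma sum_words_1: "(\<Sum>w\<in>words (Suc 0). F w) = (\<Sum>a\<in>UNIV. F [a])"
  for F :: "colour list \<Rightarrow> 'a::comm_monoid_add"
  by (rule sum.reindex_bij_witness[where i = "\<lambda>a. [a]" and j = hd])
    (auto simp: words_def length_Suc_conv)

lemma sum_words_Cons: "(\<Sum>w\<in>words (Suc k). F w) = (\<Sum>a\<in>UNIV. \<Sum>w\<in>words k. F (a # w))"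
  for F :: "colour list \<Rightarrow> 'a::comm_monoid_add"
  using sum_words_add[of F 1 k] by (simp add: sum_words_1)

lemma sum_words_snoc: "(\<Sum>w\<in>words (Suc k). F w) = (\<Sum>w\<in>words k. \<Sum>a\<in>UNIV. F (w @ [a]))"
  for F :: "colour list \<Rightarrow> 'a::comm_monoid_add"
  using sum_words_add[of F k 1] by (simp add: sum_words_1)

text \<open>
  The words that encode diagrams with \<open>n\<close> chords.
\<close>

definition double_word :: "nat \<Rightarrow> nat list \<Rightarrow> bool" where
  "double_word n w \<longleftrightarrow> set w \<subseteq> {..<n} \<and> (\<forall>i<n. count_list w i = 2)"

lemma count_list_positions: "count_list w y = card {j. j < length w \<and> w ! j = y}"
  by (simp add: count_list_eq_length_filter length_filter_conv_card eq_commute)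

lemma count_list_upt: "count_list [i..<j] y = (if i \<le> y \<and> y < j then 1 else 0)"
  by (induction j) auto

lemma double_wordI:
  "set w \<subseteq> {..<n} \<Longrightarrow> (\<And>i. i < n \<Longrightarrow> count_list w i = 2) \<Longrightarrow> double_word n w"
  by (simp add: double_word_def)

lemma map_nth_block:
  "length xs = i \<Longrightarrow> length xs + length ys = j \<Longrightarrow> map ((!) (xs @ ys @ zs)) [i..<j] = ys"
  by (rule nth_equalityI) (auto simp: nth_append)

lemma nth_blocks:
  assumes "U \<in> words k" and "R \<in> words r"
  shows "map ((!) (s # U @ R)) [Suc 0..<Suc k] = U"
    and "map ((!) (s # U @ R)) [Suc k..<Suc (k + r)] = R"
  using assms map_nth_block[of "[s]" "Suc 0" U "Suc k" R]
    map_nth_block[of "s # U" "Suc k" R "Suc (k + r)" "[]"]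
  by (simp_all add: words_def del: upt_Suc)

lemma nth_blocks2:
  assumes "U \<in> words k" and "R \<in> words r"
  shows "map ((!) (s # U @ R @ [h])) [Suc 0..<Suc k] = U"
    and "map ((!) (s # U @ R @ [h])) [Suc k..<Suc (k + r)] = R"
    and "(U @ R @ [h]) ! (k + r) = h"
  using assms map_nth_block[of "[s]" "Suc 0" U "Suc k" "R @ [h]"]
    map_nth_block[of "s # U" "Suc k" R "Suc (k + r)" "[h]"]
  by (simp_all add: words_def nth_append del: upt_Suc)

lemma sum_rotate3: "(\<Sum>u\<in>A. \<Sum>v\<in>B. \<Sum>s\<in>C. F u v s) = (\<Sum>s\<in>C. \<Sum>u\<in>A. \<Sum>v\<in>B. F u v s)"
  for F :: "'a \<Rightarrow> 'b \<Rightarrow> 'c \<Rightarrow> 'd::comm_monoid_add"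
proof -
  have "(\<Sum>u\<in>A. \<Sum>v\<in>B. \<Sum>s\<in>C. F u v s) = (\<Sum>u\<in>A. \<Sum>s\<in>C. \<Sum>v\<in>B. F u v s)"
    by (intro sum.cong refl sum.swap)
  also have "\<dots> = (\<Sum>s\<in>C. \<Sum>u\<in>A. \<Sum>v\<in>B. F u v s)" by (rule sum.swap)
  finally show ?thesis .
qed

context casimir_functional
begin

text \<open>
  Equal to the colour sum of the diagram encoded by \<open>w\<close> (\<open>colour_sum_word\<close>); the list \<open>l\<close>
  gives the colours of the letters. On words, rotation and renaming are easier to handle
  than on sets of chords.
\<close>

definition word_sum :: "nat \<Rightarrow> nat list \<Rightarrow> complex" where
  "word_sum n w = (\<Sum>l\<in>words n. L (map ((!) l) w))"

text \<open>
  Invariance under rotation of the circle. Moving the first letter to the end costs the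
  brackets with all the other letters. The two ends of each other chord give opposite
  brackets, because the tensor of that chord is invariant, and the other end of the moved
  chord itself gives \<open>[a, a] = 0\<close>.
\<close>

lemma word_sum_rotate1:
  assumes "double_word n (y # w)"
  shows "word_sum n (w @ [y]) = word_sum n (y # w)"
proof -
  define m where "m = length w"
  define c where "c l j = l ! (w ! j)" for l :: "colour list" and j
  define h where "h q = (\<Sum>l\<in>words n. \<Sum>d\<in>UNIV.
      eps (l ! (w ! q)) (l ! y) d * L (map ((c l)(q := d)) [0..<m]))" for q
  have y: "y < n" using assms by (simp add: double_word_def)
  have letters: "w ! q < n" if "q < m" for q
  proof -
    have "w ! q \<in> set w" using that by (simp add: m_def)
    then show ?thesis using assms by (auto simp: double_word_def)
  qed
  have word: "map (c l) [0..<m] = map ((!) l) w" for l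
    by (rule nth_equalityI) (auto simp: c_def m_def)
  have slide: "L (map ((!) l) (w @ [y])) = L (map ((!) l) (y # w))
      + (\<Sum>q<m. \<Sum>d\<in>UNIV. eps (l ! (w ! q)) (l ! y) d * L (map ((c l)(q := d)) [0..<m]))" for l
    using slide_left[of "[0..<m]" "[]" "c l" "l ! y" "[]"]
    by (simp add: word c_def atLeast0LessThan del: fun_upd_apply)
  have diff: "word_sum n (w @ [y]) = word_sum n (y # w) + (\<Sum>q<m. h q)"
    unfolding word_sum_def slide h_def sum.distrib by (subst (2) sum.swap) simp
  have cancel: "(\<Sum>q | q < m \<and> w ! q = z. h q) = 0" if z: "z < n" for z
  proof (cases "z = y")
    case True
    then show ?thesis by (intro sum.neutral) (auto simp: h_def)
  next
    case False
    have "count_list (y # w) z = 2" using assms z unfolding double_word_def by blast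
    then have "card {q. q < m \<and> w ! q = z} = 2"
      using False by (simp add: m_def count_list_positions[symmetric])
    then obtain q q' where qq: "{q. q < m \<and> w ! q = z} = {q, q'}" "q \<noteq> q'"
      by (auto simp: card_2_iff)
    then have q: "w ! q = z" "w ! q' = z" and only: "w ! j = z \<Longrightarrow> j < m \<Longrightarrow> j = q \<or> j = q'" for j
      by blast+
    have "h q = (\<Sum>(l, d)\<in>words n \<times> UNIV. eps (l ! z) (l ! y) d * L (map ((c l)(q := d)) [0..<m]))"
      by (simp add: h_def q sum.cartesian_product)
    \<comment> \<open>interchange the colour of the letter \<open>z\<close> with the new colour \<open>d\<close> of the position \<open>q\<close>\<close>
    also have "\<dots> = (\<Sum>(l, d)\<in>words n \<times> UNIV. - (eps (l ! z) (l ! y) d * L (map ((c l)(q' := d)) [0..<m])))"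
    proof (rule sum.reindex_bij_witness[where i = "\<lambda>(l, d). (l[z := d], l ! z)"
          and j = "\<lambda>(l, d). (l[z := d], l ! z)"], goal_cases)
      case (5 ld)
      obtain l d where ld: "ld = (l, d)" and l: "length l = n" using 5 by (cases ld) (auto simp: words_def)
      have "map ((c (l[z := d]))(q' := l ! z)) [0..<m] = map ((c l)(q := d)) [0..<m]"
      proof (rule map_cong[OF refl])
        fix j assume "j \<in> set [0..<m]"
        then have "w ! j < length l" "w ! j = z \<Longrightarrow> j = q \<or> j = q'"
          using l letters only by auto
        then show "((c (l[z := d]))(q' := l ! z)) j = ((c l)(q := d)) j"
          using l z qq(2) q by (cases "w ! j = z") (auto simp: c_def)
      qed
      moreover have "eps d (l ! y) (l ! z) = - eps (l ! z) (l ! y) d"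
        by (metis eps_rotate eps_swap)
      ultimately show ?case
        using False l z by (simp add: ld del: fun_upd_apply map_eq_conv)
    qed (use z in \<open>auto simp: words_def\<close>)
    also have "\<dots> = - h q'"
      by (simp add: h_def q sum.cartesian_product sum_negf case_prod_unfold)
    finally show ?thesis
      using qq by simp
  qed
  have "(\<Sum>q<m. h q) = (\<Sum>z<n. \<Sum>q | q \<in> {..<m} \<and> w ! q = z. h q)"
    by (rule sum.group[symmetric]) (use letters in auto)
  also have "\<dots> = 0" by (simp add: cancel)
  finally show ?thesis using diff by simp
qed

lemma word_sum_rotate:
  assumes "double_word n (u @ v)"
  shows "word_sum n (u @ v) = word_sum n (v @ u)"
  using assms
proof (induction u arbitrary: v)
  case Nil
  then show ?case by simp
next
  case (Cons y u)
  have "double_word n (u @ v @ [y])" using Cons.prems by (auto simp: double_word_def)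
  then show ?case
    using Cons.IH[of "v @ [y]"] word_sum_rotate1[of n y "u @ v"] Cons.prems by simp
qed

lemma word_sum_blocks:
  "word_sum (Suc (k + r)) w = (\<Sum>s\<in>UNIV. \<Sum>U\<in>words k. \<Sum>R\<in>words r. L (map ((!) (s # U @ R)) w))"
  by (simp add: word_sum_def sum_words_Cons sum_words_add)

lemma word_sum_blocks2:
  "word_sum (Suc (Suc (k + r))) w
    = (\<Sum>h\<in>UNIV. \<Sum>s\<in>UNIV. \<Sum>U\<in>words k. \<Sum>R\<in>words r. L (map ((!) (s # U @ R @ [h])) w))"
proof -
  have "word_sum (Suc (Suc (k + r))) w
      = (\<Sum>s\<in>UNIV. \<Sum>U\<in>words k. \<Sum>R\<in>words r. \<Sum>h\<in>UNIV. L (map ((!) (s # U @ R @ [h])) w))"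
    using word_sum_blocks[of k "Suc r" w] by (simp add: sum_words_snoc)
  also have "\<dots> = (\<Sum>s\<in>UNIV. \<Sum>h\<in>UNIV. \<Sum>U\<in>words k. \<Sum>R\<in>words r. L (map ((!) (s # U @ R @ [h])) w))"
    by (intro sum.cong refl sum_rotate3)
  also have "\<dots> = (\<Sum>h\<in>UNIV. \<Sum>s\<in>UNIV. \<Sum>U\<in>words k. \<Sum>R\<in>words r. L (map ((!) (s # U @ R @ [h])) w))"
    by (rule sum.swap)
  finally show ?thesis .
qed

text \<open>
  The colour sum of the diagram \<open>\<A>\<^sub>n\<^sub>,\<^sub>k\<close> with \<open>n = k + r + 1\<close>: \<open>s\<close> is the colour of its
  first chord, \<open>U\<close> lists the colours of the \<open>k\<close> chords that cross it and \<open>R\<close> those of the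
  \<open>r\<close> chords that do not. Since \<open>U\<close> and \<open>R\<close> run over all words of a given length, no
  relabelling of chords is ever needed.
\<close>

definition A_sum :: "nat \<Rightarrow> nat \<Rightarrow> complex" where
  "A_sum k r = (\<Sum>s\<in>UNIV. \<Sum>U\<in>words k. \<Sum>R\<in>words r. L (s # U @ s # R @ U @ R))"

text \<open>
  The colour sum of \<open>\<B>\<^sub>n\<^sub>,\<^sub>k\<close> with \<open>n = k + r + 2\<close>; \<open>h\<close> is the colour of the last chord.
\<close>

definition B_sum :: "nat \<Rightarrow> nat \<Rightarrow> complex" where
  "B_sum k r = (\<Sum>h\<in>UNIV. \<Sum>s\<in>UNIV. \<Sum>U\<in>words k. \<Sum>R\<in>words r. L (s # U @ s # R @ h # U @ h # R))"

definition D_sum :: "nat \<Rightarrow> complex" where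
  "D_sum n = (\<Sum>U\<in>words n. L (U @ U))"

lemma D_sum_0: "D_sum 0 = 1"
  by (simp add: D_sum_def sum_words_0 L_Nil)

lemma A_sum_right_0: "A_sum k 0 = D_sum (Suc k)"
  by (simp add: A_sum_def D_sum_def sum_words_0 sum_words_Cons)

lemma A_sum_left_0: "A_sum 0 r = x * D_sum r"
proof -
  have "A_sum 0 r = (\<Sum>R\<in>words r. \<Sum>s\<in>UNIV. L ([] @ s # s # R @ R))"
    unfolding A_sum_def sum_words_0 by (subst sum.swap) simp
  then show ?thesis
    unfolding casimir by (simp add: D_sum_def sum_distrib_left)
qed

lemma A_sum_left_1: "A_sum (Suc 0) r = (x - 1) * D_sum (Suc r)"
proof -
  have "A_sum (Suc 0) r = (\<Sum>s\<in>UNIV. \<Sum>a\<in>UNIV. \<Sum>R\<in>words r. L (s # a # s # R @ a # R))"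
    by (simp add: A_sum_def sum_words_1)
  also have "\<dots> = (\<Sum>R\<in>words r. \<Sum>s\<in>UNIV. \<Sum>a\<in>UNIV. L (s # a # s # R @ a # R))"
    by (rule sum_rotate3)
  also have "\<dots> = (x - 1) * (\<Sum>R\<in>words r. \<Sum>a\<in>UNIV. L (a # R @ a # R))"
    unfolding isolated_crossing by (simp add: sum_distrib_left)
  also have "(\<Sum>R\<in>words r. \<Sum>a\<in>UNIV. L (a # R @ a # R)) = D_sum (Suc r)"
    by (subst sum.swap) (simp add: D_sum_def sum_words_Cons)
  finally show ?thesis .
qed

text \<open>
  After a rotation the chord \<open>s\<close> cuts off a copy of \<open>R\<close> instead of \<open>U R U\<close>.
\<close>

lemma A_sum_rotate:
  "(\<Sum>s\<in>UNIV. \<Sum>U\<in>words k. \<Sum>R\<in>words r. L (s # U @ R @ U @ s # R)) = A_sum r k"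
proof -
  let ?n = "Suc (k + r)" and ?U = "[Suc 0..<Suc k]" and ?R = "[Suc k..<Suc (k + r)]"
  have "double_word ?n (([0] @ ?U @ ?R @ ?U) @ ([0] @ ?R))"
    by (rule double_wordI) (auto simp: count_list_upt simp del: upt_Suc)
  then have "word_sum ?n (([0] @ ?U @ ?R @ ?U) @ ([0] @ ?R))
      = word_sum ?n (([0] @ ?R) @ ([0] @ ?U @ ?R @ ?U))"
    by (rule word_sum_rotate)
  then have "(\<Sum>s\<in>UNIV. \<Sum>U\<in>words k. \<Sum>R\<in>words r. L (s # U @ R @ U @ s # R))
      = (\<Sum>s\<in>UNIV. \<Sum>U\<in>words k. \<Sum>R\<in>words r. L (s # R @ s # U @ R @ U))"
    unfolding word_sum_blocks by (simp add: nth_blocks del: upt_Suc)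
  also have "\<dots> = A_sum r k"
    unfolding A_sum_def by (intro sum.cong refl sum.swap)
  finally show ?thesis .
qed

lemma A_sum_rotate_last:
  "(\<Sum>h\<in>UNIV. \<Sum>s\<in>UNIV. \<Sum>U\<in>words k. \<Sum>R\<in>words r. L (h # s # U @ s # R @ h # U @ R)) = A_sum k (Suc r)"
proof -
  let ?n = "Suc (Suc (k + r))" and ?U = "[Suc 0..<Suc k]" and ?R = "[Suc k..<Suc (k + r)]" and ?h
      = "[Suc (k + r)]"
  have "double_word ?n (([0] @ ?U @ [0] @ ?R @ ?h @ ?U @ ?R) @ ?h)"
    by (rule double_wordI) (auto simp: count_list_upt simp del: upt_Suc)
  then have "word_sum ?n (([0] @ ?U @ [0] @ ?R @ ?h @ ?U @ ?R) @ ?h)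
      = word_sum ?n (?h @ ([0] @ ?U @ [0] @ ?R @ ?h @ ?U @ ?R))"
    by (rule word_sum_rotate)
  then have "(\<Sum>h\<in>UNIV. \<Sum>s\<in>UNIV. \<Sum>U\<in>words k. \<Sum>R\<in>words r. L (h # s # U @ s # R @ h # U @ R))
      = (\<Sum>h\<in>UNIV. \<Sum>s\<in>UNIV. \<Sum>U\<in>words k. \<Sum>R\<in>words r. L (s # U @ s # R @ h # U @ R @ [h]))"
    unfolding word_sum_blocks2 by (simp add: nth_blocks2 del: upt_Suc)
  also have "\<dots> = (\<Sum>s\<in>UNIV. \<Sum>h\<in>UNIV. \<Sum>U\<in>words k. \<Sum>R\<in>words r. L (s # U @ s # R @ h # U @ R @ [h]))"
    by (rule sum.swap)
  also have "\<dots> = (\<Sum>s\<in>UNIV. \<Sum>U\<in>words k. \<Sum>R\<in>words r. \<Sum>h\<in>UNIV. L (s # U @ s # R @ h # U @ R @ [h]))"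
    by (intro sum.cong refl sum_rotate3[symmetric])
  also have "\<dots> = A_sum k (Suc r)"
    by (simp add: A_sum_def sum_words_snoc)
  finally show ?thesis .
qed

lemma B_sum_rotate:
  "(\<Sum>h\<in>UNIV. \<Sum>s\<in>UNIV. \<Sum>U\<in>words k. \<Sum>R\<in>words r. L (s # U @ h # R @ h # U @ s # R)) = B_sum r k"
proof -
  let ?n = "Suc (Suc (k + r))" and ?U = "[Suc 0..<Suc k]" and ?R = "[Suc k..<Suc (k + r)]" and ?h
      = "[Suc (k + r)]"
  have "double_word ?n (([0] @ ?U @ ?h @ ?R @ ?h @ ?U) @ ([0] @ ?R))"
    by (rule double_wordI) (auto simp: count_list_upt simp del: upt_Suc)
  then have "word_sum ?n (([0] @ ?U @ ?h @ ?R @ ?h @ ?U) @ ([0] @ ?R))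
      = word_sum ?n (([0] @ ?R) @ ([0] @ ?U @ ?h @ ?R @ ?h @ ?U))"
    by (rule word_sum_rotate)
  then have "(\<Sum>h\<in>UNIV. \<Sum>s\<in>UNIV. \<Sum>U\<in>words k. \<Sum>R\<in>words r. L (s # U @ h # R @ h # U @ s # R))
      = (\<Sum>h\<in>UNIV. \<Sum>s\<in>UNIV. \<Sum>U\<in>words k. \<Sum>R\<in>words r. L (s # R @ s # U @ h # R @ h # U))"
    unfolding word_sum_blocks2 by (simp add: nth_blocks2 del: upt_Suc)
  also have "\<dots> = B_sum r k"
    unfolding B_sum_def by (intro sum.cong refl sum.swap)
  finally show ?thesis .
qed

end

section \<open>The families of diagrams in terms of colours\<close>

context casimir_functional
begin

lemma sum_words_rotate3:
  "(\<Sum>U\<in>words k. \<Sum>R\<in>words r. \<Sum>s\<in>UNIV. F U R s) = (\<Sum>s\<in>UNIV. \<Sum>U\<in>words k. \<Sum>R\<in>words r. F U R s)"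
  for F :: "colour list \<Rightarrow> colour list \<Rightarrow> colour \<Rightarrow> complex"
  by (rule sum_rotate3)

lemma sum_words_rotate4:
  "(\<Sum>U\<in>words k. \<Sum>R\<in>words r. \<Sum>s\<in>UNIV. \<Sum>a\<in>UNIV. F U R s a)
    = (\<Sum>s\<in>UNIV. \<Sum>U\<in>words k. \<Sum>a\<in>UNIV. \<Sum>R\<in>words r. F U R s a)"
  for F :: "colour list \<Rightarrow> colour list \<Rightarrow> colour \<Rightarrow> colour \<Rightarrow> complex"
  by (subst sum_words_rotate3) (intro sum.cong refl sum.swap)

lemma sum_words_rotate5:
  "(\<Sum>U\<in>words k. \<Sum>R\<in>words r. \<Sum>s\<in>UNIV. \<Sum>a\<in>UNIV. \<Sum>b\<in>UNIV. F U R s a b)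
    = (\<Sum>s\<in>UNIV. \<Sum>U\<in>words k. \<Sum>a\<in>UNIV. \<Sum>b\<in>UNIV. \<Sum>R\<in>words r. F U R s a b)"
  for F :: "colour list \<Rightarrow> colour list \<Rightarrow> colour \<Rightarrow> colour \<Rightarrow> colour \<Rightarrow> complex"
proof -
  have "(\<Sum>U\<in>words k. \<Sum>R\<in>words r. \<Sum>s\<in>UNIV. \<Sum>a\<in>UNIV. \<Sum>b\<in>UNIV. F U R s a b)
      = (\<Sum>s\<in>UNIV. \<Sum>U\<in>words k. \<Sum>a\<in>UNIV. \<Sum>R\<in>words r. \<Sum>b\<in>UNIV. F U R s a b)"
    by (rule sum_words_rotate4)
  also have "\<dots> = (\<Sum>s\<in>UNIV. \<Sum>U\<in>words k. \<Sum>a\<in>UNIV. \<Sum>b\<in>UNIV. \<Sum>R\<in>words r. F U R s a b)"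
    by (intro sum.cong refl sum.swap)
  finally show ?thesis .
qed

lemma A_sum_Suc_right:
  "A_sum k (Suc r) = (\<Sum>s\<in>UNIV. \<Sum>U\<in>words k. \<Sum>a\<in>UNIV. \<Sum>R\<in>words r. L (s # U @ s # a # R @ U @ a # R))"
  by (simp add: A_sum_def sum_words_Cons)

lemma A_sum_Suc_left:
  "A_sum (Suc k) r = (\<Sum>s\<in>UNIV. \<Sum>U\<in>words k. \<Sum>a\<in>UNIV. \<Sum>R\<in>words r. L (s # U @ a # s # R @ U @ a # R))"
  by (simp add: A_sum_def sum_words_snoc)

text \<open>
  The contraction of the complete diagram on \<open>k + r + 1\<close> chords in which the chord number
  \<open>k + 1\<close> has been replaced by a trivalent vertex with its third leg in front of the first
  chord. It will turn out to be the value of \<open>K_poly (k + r + 1) (k + 1)\<close>.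
\<close>

definition tripod_sum :: "nat \<Rightarrow> nat \<Rightarrow> complex" where
  "tripod_sum k r = A_sum k (Suc r) - A_sum (Suc k) r"

text \<open>
  Taking the bracket at the other end of the distinguished chord and rotating the circle
  interchanges the roles of the chords before and after it.
\<close>

lemma tripod_sum_commute: "tripod_sum k r = tripod_sum r k"
proof -
  have "tripod_sum k r = (\<Sum>U\<in>words k. \<Sum>R\<in>words r. \<Sum>s\<in>UNIV. \<Sum>a\<in>UNIV.
      L (s # U @ s # a # (R @ U) @ a # R) - L (s # U @ a # s # (R @ U) @ a # R))"
    unfolding sum_words_rotate4 tripod_sum_def A_sum_Suc_right A_sum_Suc_left by (simp add: sum_subtractf)
  also have "\<dots> = (\<Sum>U\<in>words k. \<Sum>R\<in>words r. \<Sum>s\<in>UNIV. \<Sum>a\<in>UNIV.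
      L (s # U @ a # (R @ U) @ a # s # R) - L (s # U @ a # (R @ U) @ s # a # R))"
    unfolding tripod_symmetry ..
  also have "\<dots> = (\<Sum>s\<in>UNIV. \<Sum>U\<in>words (Suc k). \<Sum>R\<in>words r. L (s # U @ R @ U @ s # R))
      - (\<Sum>s\<in>UNIV. \<Sum>U\<in>words k. \<Sum>R\<in>words (Suc r). L (s # U @ R @ U @ s # R))"
    unfolding sum_words_rotate4 sum_words_snoc[of _ k] sum_words_Cons[of _ r] by (simp add: sum_subtractf)
  also have "\<dots> = tripod_sum r k"
    unfolding A_sum_rotate tripod_sum_def ..
  finally show ?thesis .
qed

text \<open>
  Moving the trivalent vertex to the next chord. Up to the factor \<open>x\<close>, each of the four
  terms on the right is a diagram of the family \<open>\<A>\<close>, two of them after a rotation, so taking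
  one more difference closes up to a recursion for \<open>tripod_sum\<close> alone.
\<close>

lemma tripod_sum_difference:
  "tripod_sum k (Suc r) - tripod_sum (Suc k) r
    = x * A_sum k r - A_sum r (Suc k) + A_sum k (Suc r) - x * A_sum r k"
proof -
  let ?S = "\<lambda>F. \<Sum>U\<in>words k. \<Sum>R\<in>words r. F U R"
  have e: "A_sum k (Suc (Suc r)) = (\<Sum>s\<in>UNIV. \<Sum>U\<in>words k. \<Sum>a\<in>UNIV. \<Sum>b\<in>UNIV. \<Sum>R\<in>words r.
        L (s # U @ s # a # b # (R @ U) @ a # b # R))"
    "A_sum (Suc k) (Suc r) = (\<Sum>s\<in>UNIV. \<Sum>U\<in>words k. \<Sum>a\<in>UNIV. \<Sum>b\<in>UNIV. \<Sum>R\<in>words r.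
        L (s # U @ a # s # b # (R @ U) @ a # b # R))"
    "A_sum (Suc (Suc k)) r = (\<Sum>s\<in>UNIV. \<Sum>U\<in>words k. \<Sum>a\<in>UNIV. \<Sum>b\<in>UNIV. \<Sum>R\<in>words r.
        L (s # U @ a # b # s # (R @ U) @ a # b # R))"
    by (simp_all add: A_sum_Suc_right[of k "Suc r"] A_sum_Suc_left[of k "Suc r"] A_sum_Suc_left[of
        "Suc k" r]
        sum_words_Cons[of _ r] sum_words_snoc[of _ k])
  have "tripod_sum k (Suc r) - tripod_sum (Suc k) r
      = ?S (\<lambda>U R. \<Sum>s\<in>UNIV. \<Sum>a\<in>UNIV. \<Sum>b\<in>UNIV. L (s # U @ s # a # b # (R @ U) @ a # b # R)
        - 2 * L (s # U @ a # s # b # (R @ U) @ a # b # R) + L (s # U @ a # b # s # (R @ U) @ a # b # R))"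
    unfolding sum_words_rotate5 tripod_sum_def e
    by (simp add: sum_subtractf sum.distrib sum_distrib_left[symmetric])
  also have "\<dots> = ?S (\<lambda>U R. x * (\<Sum>s\<in>UNIV. L (s # U @ s # (R @ U) @ R))
      - (\<Sum>s\<in>UNIV. \<Sum>a\<in>UNIV. L (s # U @ a # (R @ U) @ a # s # R))
      + (\<Sum>s\<in>UNIV. \<Sum>a\<in>UNIV. L (s # U @ s # a # (R @ U) @ a # R))
      - x * (\<Sum>s\<in>UNIV. L (s # U @ (R @ U) @ s # R)))"
    unfolding second_difference ..
  also have "\<dots> = x * ?S (\<lambda>U R. \<Sum>s\<in>UNIV. L (s # U @ s # (R @ U) @ R))
      - ?S (\<lambda>U R. \<Sum>s\<in>UNIV. \<Sum>a\<in>UNIV. L (s # U @ a # (R @ U) @ a # s # R))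
      + ?S (\<lambda>U R. \<Sum>s\<in>UNIV. \<Sum>a\<in>UNIV. L (s # U @ s # a # (R @ U) @ a # R))
      - x * ?S (\<lambda>U R. \<Sum>s\<in>UNIV. L (s # U @ (R @ U) @ s # R))"
    by (simp only: sum_subtractf sum.distrib sum_distrib_left[symmetric])
  also have "?S (\<lambda>U R. \<Sum>s\<in>UNIV. L (s # U @ s # (R @ U) @ R)) = A_sum k r"
    unfolding sum_words_rotate3 A_sum_def by simp
  also have "?S (\<lambda>U R. \<Sum>s\<in>UNIV. L (s # U @ (R @ U) @ s # R)) = A_sum r k"
    unfolding sum_words_rotate3 A_sum_rotate[symmetric] by simp
  also have "?S (\<lambda>U R. \<Sum>s\<in>UNIV. \<Sum>a\<in>UNIV. L (s # U @ a # (R @ U) @ a # s # R)) = A_sum r (Suc k)"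
    unfolding sum_words_rotate4 A_sum_rotate[symmetric] sum_words_snoc[of _ k] by simp
  also have "?S (\<lambda>U R. \<Sum>s\<in>UNIV. \<Sum>a\<in>UNIV. L (s # U @ s # a # (R @ U) @ a # R)) = A_sum k (Suc r)"
    unfolding sum_words_rotate4 A_sum_Suc_right by simp
  finally show ?thesis .
qed

text \<open>
  The difference is a tree with four legs, that is, a trivalent vertex whose third leg is
  bracketed with one end of a chord \<open>h\<close>. In one term of this bracket \<open>h\<close> is the first chord
  of a complete diagram with a trivalent vertex; in the other term a rotation makes \<open>h\<close> the
  last chord.
\<close>

lemma B_sum_difference:
  "B_sum k r - B_sum r k = tripod_sum k (Suc r) - tripod_sum (Suc k) r"
proof -
  let ?S = "\<lambda>F. \<Sum>h\<in>UNIV. \<Sum>s\<in>UNIV. \<Sum>U\<in>words k. \<Sum>a\<in>UNIV. \<Sum>R\<in>words r. F U R h s a"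
  have order: "(\<Sum>U\<in>words k. \<Sum>R\<in>words r. \<Sum>h\<in>UNIV. \<Sum>s\<in>UNIV. \<Sum>a\<in>UNIV. F U R h s a) = ?S F"
    for F :: "colour list \<Rightarrow> colour list \<Rightarrow> colour \<Rightarrow> colour \<Rightarrow> colour \<Rightarrow> complex"
    by (subst sum_words_rotate3) (intro sum.cong refl sum_words_rotate4)
  have e: "A_sum k (Suc (Suc r)) = ?S (\<lambda>U R h s a. L (h # s # U @ s # a # R @ h # U @ a # R))"
    "A_sum (Suc k) (Suc r) = ?S (\<lambda>U R h s a. L (h # s # U @ a # s # R @ h # U @ a # R))"
    by (simp_all add: A_sum_rotate_last[symmetric] sum_words_Cons[of _ r] sum_words_snoc[of _ k])
  have e': "A_sum (Suc k) (Suc r) = ?S (\<lambda>U R h s a. L (s # h # U @ s # a # R @ h # U @ a # R))"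
    by (subst sum.swap) (simp add: A_sum_def sum_words_Cons)
  have e'': "A_sum (Suc (Suc k)) r = ?S (\<lambda>U R h s a. L (s # h # U @ a # s # R @ h # U @ a # R))"
    by (subst sum.swap) (simp add: A_sum_def sum_words_Cons[of _ "Suc k"] sum_words_snoc[of _ k])
  have "tripod_sum k (Suc r) - tripod_sum (Suc k) r
      = ?S (\<lambda>U R h s a. (L (h # s # U @ s # a # R @ h # U @ a # R)
          - L (h # s # U @ a # s # R @ h # U @ a # R))
        - (L (s # h # U @ s # a # R @ h # U @ a # R) - L (s # h # U @ a # s # R @ h # U @ a # R)))"
    unfolding sum_subtractf e[symmetric] e'[symmetric] e''[symmetric] by (simp add: tripod_sum_def)
  also have "\<dots> = (\<Sum>U\<in>words k. \<Sum>R\<in>words r.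
      (\<Sum>h\<in>UNIV. \<Sum>s\<in>UNIV. L (s # U @ s # R @ h # U @ h # R))
      - (\<Sum>h\<in>UNIV. \<Sum>s\<in>UNIV. L (s # U @ h # R @ h # U @ s # R)))"
    unfolding order[symmetric] bracketed_crossing ..
  also have "\<dots> = B_sum k r - B_sum r k"
    unfolding sum_subtractf sum_words_rotate3 B_sum_rotate B_sum_def[of k r, symmetric] ..
  finally show ?thesis ..
qed

end

section \<open>Diagrams given by words\<close>

lemma diagram_of_word_map:
  assumes "inj_on f (set w)"
  shows "diagram_of_word (map f w) = diagram_of_word w"
proof -
  have "i < j \<and> j < length (map f w) \<and> map f w ! i = map f w ! j \<longleftrightarrow> i < j \<and> j < length w \<and> w ! i = w ! j"
    for i j
    using inj_on_eq_iff[OF assms, of "w ! i" "w ! j"] by (cases "i < j"; cases "j < length w") auto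
  then show ?thesis unfolding diagram_of_word_def by simp
qed

lemma card_positions:
  "double_word n w \<Longrightarrow> y < n \<Longrightarrow> card {p. p < length w \<and> w ! p = y} = 2"
  by (simp add: double_word_def flip: count_list_positions)

text \<open>
  The chords of a double word are the fibres of its letters.
\<close>

lemma diagram_of_word_eq:
  assumes "double_word n w"
  shows "diagram_of_word w = (\<lambda>y. Suc ` {p. p < length w \<and> w ! p = y}) ` {..<n}"
proof (intro set_eqI iffI)
  fix b assume "b \<in> diagram_of_word w"
  then obtain i j where ij: "b = {Suc i, Suc j}" "i < j" "j < length w" "w ! i = w ! j"
    by (auto simp: diagram_of_word_def)
  have "w ! j \<in> set w" using ij by simp
  then have y: "w ! j < n" using assms by (auto simp: double_word_def)
  have "{i, j} \<subseteq> {p. p < length w \<and> w ! p = w ! j}" using ij by auto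
  then have "{i, j} = {p. p < length w \<and> w ! p = w ! j}"
    using ij by (intro card_subset_eq) (simp_all add: card_positions[OF assms y])
  then have "b = Suc ` {p. p < length w \<and> w ! p = w ! j}"
    using ij(1) by (metis image_empty image_insert)
  then show "b \<in> (\<lambda>y. Suc ` {p. p < length w \<and> w ! p = y}) ` {..<n}" using y by blast
next
  fix b assume "b \<in> (\<lambda>y. Suc ` {p. p < length w \<and> w ! p = y}) ` {..<n}"
  then obtain y where y: "y < n" "b = Suc ` {p. p < length w \<and> w ! p = y}" by auto
  obtain i j where "{p. p < length w \<and> w ! p = y} = {i, j}" "i < j"
    using card_positions[OF assms y(1)]
    by (metis (no_types, lifting) card_2_iff insert_commute linorder_neqE_nat)
  moreover from this have "i < length w \<and> w ! i = y" "j < length w \<and> w ! j = y" by blast+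
  ultimately show "b \<in> diagram_of_word w"
    unfolding y(2) diagram_of_word_def mem_Collect_eq
    by (intro exI[of _ i] exI[of _ j]) simp
qed

lemma chord_diagram_of_word:
  assumes "double_word n w"
  shows "chord_diagram (diagram_of_word w)"
  unfolding chord_diagram_def
proof (intro conjI ballI impI)
  show "finite (diagram_of_word w)" unfolding diagram_of_word_eq[OF assms] by simp
  show "card b = 2" if "b \<in> diagram_of_word w" for b
    using that card_positions[OF assms] by (auto simp: diagram_of_word_eq[OF assms] card_image)
  show "b \<inter> c = {}" if "b \<in> diagram_of_word w" "c \<in> diagram_of_word w" "b \<noteq> c" for b c
    using that by (auto simp: diagram_of_word_eq[OF assms])
qed

context casimir_functional
begin

text \<open>
  A colouring of the endpoints that is constant on chords is a colouring of the letters.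
\<close>

lemma colour_sum_word:
  assumes "double_word n w"
  shows "colour_sum (diagram_of_word w) = word_sum n w"
proof -
  define m where "m = length w"
  define pos where "pos y = (SOME p. p < m \<and> w ! p = y)" for y
  have pos: "pos y < m" "w ! pos y = y" if "y < n" for y
  proof -
    have "card {p. p < m \<and> w ! p = y} = 2" using card_positions[OF assms that] by (simp add: m_def)
    then have "{p. p < m \<and> w ! p = y} \<noteq> {}" by (metis card.empty zero_neq_numeral)
    then have "\<exists>p. p < m \<and> w ! p = y" by blast
    then have "pos y < m \<and> w ! pos y = y" unfolding pos_def by (rule someI_ex)
    then show "pos y < m" "w ! pos y = y" by simp_all
  qed
  have letter: "w ! p < n" if "p < m" for p
  proof -
    have "w ! p \<in> set w" using that by (simp add: m_def)
    then show ?thesis using assms by (auto simp: double_word_def)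
  qed
  have points: "\<Union>(diagram_of_word w) = Suc ` {..<m}"
  proof (intro set_eqI iffI)
    fix p assume "p \<in> Suc ` {..<m}"
    then obtain i where i: "p = Suc i" "i < m" by auto
    then have "p \<in> Suc ` {q. q < length w \<and> w ! q = w ! i}" by (simp add: m_def)
    then show "p \<in> \<Union>(diagram_of_word w)"
      unfolding diagram_of_word_eq[OF assms] using letter[OF i(2)] by blast
  qed (auto simp: diagram_of_word_eq[OF assms] m_def)
  have sorted: "sorted_list_of_set (Suc ` {..<m}) = map Suc [0..<m]"
    by (simp only: lessThan_atLeast0 image_Suc_atLeastLessThan sorted_list_of_set_range map_Suc_upt)
  have mem: "c \<in> colourings (diagram_of_word w) \<longleftrightarrow> (\<forall>p. p \<notin> Suc ` {..<m} \<longrightarrow> c p = undefined)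
      \<and> (\<forall>p<m. \<forall>q<m. w ! p = w ! q \<longrightarrow> c (Suc p) = c (Suc q))" for c
  proof -
    have "constant_on_chords (diagram_of_word w) c
        \<longleftrightarrow> (\<forall>p<m. \<forall>q<m. w ! p = w ! q \<longrightarrow> c (Suc p) = c (Suc q))"
    proof
      assume *: "constant_on_chords (diagram_of_word w) c"
      show "\<forall>p<m. \<forall>q<m. w ! p = w ! q \<longrightarrow> c (Suc p) = c (Suc q)"
      proof (intro allI impI)
        fix p q assume pq: "p < m" "q < m" "w ! p = w ! q"
        let ?b = "Suc ` {r. r < length w \<and> w ! r = w ! q}"
        have "?b \<in> diagram_of_word w"
          unfolding diagram_of_word_eq[OF assms] using letter[OF pq(2)] by blast
        moreover have "Suc p \<in> ?b" "Suc q \<in> ?b" using pq by (simp_all add: m_def)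
        ultimately show "c (Suc p) = c (Suc q)"
          by (rule *[unfolded constant_on_chords_def, rule_format])
      qed
    next
      assume *: "\<forall>p<m. \<forall>q<m. w ! p = w ! q \<longrightarrow> c (Suc p) = c (Suc q)"
      have "c (Suc p) = c (Suc q)" if "p < length w \<and> w ! p = y" "q < length w \<and> w ! q = y" for p q y
        using *[rule_format, of p q] that by (simp add: m_def)
      then show "constant_on_chords (diagram_of_word w) c"
        unfolding constant_on_chords_def diagram_of_word_eq[OF assms] by blast
    qed
    then show ?thesis by (simp only: mem_colourings points)
  qed
  have same: "c (Suc (pos (w ! p))) = c (Suc p)" if "c \<in> colourings (diagram_of_word w)" "p < m" for c p
  proof -
    have "\<forall>p<m. \<forall>q<m. w ! p = w ! q \<longrightarrow> c (Suc p) = c (Suc q)" 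
      by (rule conjunct2[OF iffD1[OF mem that(1)]])
    then show ?thesis using pos[OF letter[OF that(2)]] that(2) by metis
  qed
  show ?thesis
    unfolding colour_sum_def word_sum_def points sorted
  proof (rule sum.reindex_bij_witness[where i = "\<lambda>l p. if p \<in> Suc ` {..<m} then l ! (w ! (p
      - 1)) else undefined"
        and j = "\<lambda>c. map (\<lambda>y. c (Suc (pos y))) [0..<n]"], goal_cases)
    case (1 c)
    show ?case
    proof
      fix p
      show "(if p \<in> Suc ` {..<m} then map (\<lambda>y. c (Suc (pos y))) [0..<n] ! (w ! (p
          - 1)) else undefined) = c p"
      proof (cases "p \<in> Suc ` {..<m}")
        case True
        then obtain q where q: "p = Suc q" "q < m" by auto
        then show ?thesis using same[OF 1 q(2)] letter[OF q(2)] by simp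
      qed (use 1 in \<open>simp add: mem\<close>)
    qed
  next
    case (2 c)
    show ?case by (simp add: words_def)
  next
    case (3 l)
    then show ?case using pos by (intro nth_equalityI) (auto simp: words_def)
  next
    case (4 l)
    then show ?case by (auto simp: mem)
  next
    case (5 c)
    have "map ((!) (map (\<lambda>y. c (Suc (pos y))) [0..<n])) w = map c (map Suc [0..<m])"
    proof (rule nth_equalityI)
      show "length (map ((!) (map (\<lambda>y. c (Suc (pos y))) [0..<n])) w) = length (map c (map Suc [0..<m]))"
        by (simp add: m_def)
      fix i assume "i < length (map ((!) (map (\<lambda>y. c (Suc (pos y))) [0..<n])) w)"
      then have i: "i < m" by (simp add: m_def)
      then have "c (Suc (pos (w ! i))) = c (Suc i)"
        by (rule same[OF 5])
      then show "map ((!) (map (\<lambda>y. c (Suc (pos y))) [0..<n])) w ! i = map c (map Suc [0..<m]) ! i"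
        using i letter[OF i] by (simp add: m_def[symmetric])
    qed
    then show ?case by simp
  qed
qed

lemma colour_sum_relabelled_word:
  "double_word n w \<Longrightarrow> colour_sum (diagram_of_word (map Suc w)) = word_sum n w"
  by (simp add: diagram_of_word_map colour_sum_word)

end

lemma A_diagram_word:
  "A_diagram (Suc (k + r)) k
    = diagram_of_word (map Suc ([0] @ [1..<Suc k] @ [0] @ [Suc k..<Suc (k
        + r)] @ [1..<Suc k] @ [Suc k..<Suc (k + r)]))"
proof -
  have "[1..<k + 2] = [1] @ [2..<k + 2]" by (simp add: upt_conv_Cons numeral_2_eq_2 del: upt_Suc)
  moreover have "[2..<Suc (Suc (k + r))] = [2..<k + 2] @ [k + 2..<Suc (Suc (k + r))]"
    using upt_add_eq_append[of 2 "k + 2" r] by simp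
  ultimately show ?thesis
    by (simp add: A_diagram_def map_Suc_upt numeral_2_eq_2 del: upt_Suc)
qed

lemma A_word: "double_word (Suc (k + r)) ([0] @ [1..<Suc k] @ [0] @ [Suc k..<Suc (k
    + r)] @ [1..<Suc k] @ [Suc k..<Suc (k + r)])"
  by (rule double_wordI) (auto simp: count_list_upt simp del: upt_Suc)

lemma B_diagram_word:
  "B_diagram (Suc (Suc (k + r))) k
    = diagram_of_word (map Suc ([0] @ [1..<Suc k] @ [0] @ [Suc k..<Suc (k + r)] @ [Suc (k + r)]
        @ [1..<Suc k] @ [Suc (k + r)] @ [Suc k..<Suc (k + r)]))"
proof -
  have "[1..<k + 2] = [1] @ [2..<k + 2]" by (simp add: upt_conv_Cons numeral_2_eq_2 del: upt_Suc)
  moreover have "[k + 2..<Suc (Suc (Suc (k + r)))] = [k + 2..<Suc (Suc (k + r))] @ [Suc (Suc (k + r))]"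
    by simp
  ultimately show ?thesis
    by (simp add: B_diagram_def map_Suc_upt numeral_2_eq_2 del: upt_Suc)
qed

lemma B_word: "double_word (Suc (Suc (k + r))) ([0] @ [1..<Suc k] @ [0] @ [Suc k..<Suc (k
    + r)] @ [Suc (k + r)]
        @ [1..<Suc k] @ [Suc (k + r)] @ [Suc k..<Suc (k + r)])"
  by (rule double_wordI) (auto simp: count_list_upt simp del: upt_Suc)

lemma D_diagram_word: "D_diagram n = diagram_of_word (map Suc ([0..<n] @ [0..<n]))"
proof -
  have "D_diagram n = diagram_of_word ([0..<n] @ [0..<n])"
  proof (intro set_eqI iffI)
    fix b assume "b \<in> D_diagram n"
    then obtain i where "b = {i, n + i}" "1 \<le> i" "i \<le> n" by (auto simp: D_diagram_def)
    then obtain i where i: "b = {Suc i, n + Suc i}" "i < n" by (cases i) auto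
    show "b \<in> diagram_of_word ([0..<n] @ [0..<n])"
      unfolding diagram_of_word_def mem_Collect_eq
      by (rule exI[of _ i], rule exI[of _ "n + i"]) (use i in \<open>simp add: nth_append\<close>)
  next
    fix b assume "b \<in> diagram_of_word ([0..<n] @ [0..<n])"
    then obtain i j where ij: "b = {Suc i, Suc j}" "i < j" "j < n + n"
      "([0..<n] @ [0..<n]) ! i = ([0..<n] @ [0..<n]) ! j" by (auto simp: diagram_of_word_def)
    have "i < n" "j = n + i"
      using ij(2-4) by (cases "i < n"; cases "j < n"; simp add: nth_append)+
    then show "b \<in> D_diagram n"
      unfolding D_diagram_def mem_Collect_eq ij(1) by (intro exI[of _ "Suc i"]) simp
  qed
  then show ?thesis by (simp only: diagram_of_word_map inj_Suc)
qed

lemma D_word: "double_word n ([0..<n] @ [0..<n])"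
  by (rule double_wordI) (auto simp: count_list_upt)

context casimir_functional
begin

lemma colour_sum_A_diagram: "colour_sum (A_diagram (Suc (k + r)) k) = A_sum k r"
  unfolding A_diagram_word colour_sum_relabelled_word[OF A_word] word_sum_blocks A_sum_def
  by (simp add: nth_blocks del: upt_Suc)

lemma colour_sum_B_diagram: "colour_sum (B_diagram (Suc (Suc (k + r))) k) = B_sum k r"
  unfolding B_diagram_word colour_sum_relabelled_word[OF B_word] word_sum_blocks2 B_sum_def
  by (simp add: nth_blocks2 del: upt_Suc)

lemma colour_sum_D_diagram: "colour_sum (D_diagram n) = D_sum n"
proof -
  have "map ((!) U) [0..<n] = U" if "U \<in> words n" for U
    using that map_nth[of U] by (simp add: words_def)
  then show ?thesis
    unfolding D_diagram_word colour_sum_relabelled_word[OF D_word] word_sum_def D_sum_def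
    by simp
qed

end

section \<open>Comparison with the recursive family\<close>

text \<open>
  The recursion of \<open>K_poly\<close> with the indices arranged so that no subtraction of natural
  numbers occurs.
\<close>

lemma K_poly_recursion:
  "K_poly 0 1 = 1"
  "K_poly 1 1 = X"
  "K_poly (Suc (Suc m)) 1 = (X - 1) * K_poly (Suc m) 1 - (\<Sum>i<m. K_poly (Suc m) (Suc (Suc i)))"
  "K_poly (Suc (Suc m)) 2 = 2 * K_poly (Suc (Suc m)) 1 + K_poly (Suc m) 1 - X^2 * K_poly m 1"
  "K_poly (Suc (Suc (Suc (k + r)))) (Suc (Suc (Suc k)))
    = 2 * K_poly (Suc (Suc (Suc (k + r)))) (Suc (Suc k)) - K_poly (Suc (Suc (Suc (k + r)))) (Suc k)
      + K_poly (Suc (Suc (k + r))) (Suc (Suc k)) + K_poly (Suc (Suc (k + r))) (Suc k)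
      + 2 * X * K_poly (Suc (k + r)) (Suc k)"
proof -
  show "K_poly 0 1 = 1" "K_poly 1 1 = X" by (subst K_poly.simps, simp)+
  have "(\<Sum>j=2..Suc m. K_poly (Suc m) j) = (\<Sum>i<m. K_poly (Suc m) (Suc (Suc i)))"
    by (rule sum.reindex_bij_witness[where i = "\<lambda>i. Suc (Suc i)" and j = "\<lambda>j. j - 2"])
      (auto intro!: arg_cong[of _ _ "K_poly _"])
  then show "K_poly (Suc (Suc m)) 1 = (X - 1) * K_poly (Suc m) 1 - (\<Sum>i<m. K_poly (Suc m) (Suc (Suc i)))"
    by (subst K_poly.simps) simp
  show "K_poly (Suc (Suc m)) 2 = 2 * K_poly (Suc (Suc m)) 1 + K_poly (Suc m) 1 - X^2 * K_poly m 1"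
    by (subst K_poly.simps) simp
  show "K_poly (Suc (Suc (Suc (k + r)))) (Suc (Suc (Suc k)))
    = 2 * K_poly (Suc (Suc (Suc (k + r)))) (Suc (Suc k)) - K_poly (Suc (Suc (Suc (k + r)))) (Suc k)
      + K_poly (Suc (Suc (k + r))) (Suc (Suc k)) + K_poly (Suc (Suc (k + r))) (Suc k)
      + 2 * X * K_poly (Suc (k + r)) (Suc k)"
    by (subst K_poly.simps) (simp add: numeral_2_eq_2)
qed

context casimir_functional
begin

lemma tripod_sum_left_0: "tripod_sum 0 r = D_sum (Suc r)"
  by (simp add: tripod_sum_def A_sum_left_0 A_sum_left_1 algebra_simps)

text \<open>
  The sum in the first recursion of \<open>K_poly\<close> telescopes between a chord that crosses one
  other chord and a chord that crosses all of them.
\<close>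

lemma tripod_sum_telescope:
  "(\<Sum>i<m. tripod_sum (Suc i) (m - Suc i)) = (x - 1) * D_sum (Suc m) - D_sum (Suc (Suc m))"
proof -
  have "tripod_sum (Suc i) (m - Suc i) = A_sum (Suc i) (m - i) - A_sum (Suc (Suc i)) (m - Suc i)"
      if "i < m" for i
    using that by (simp add: tripod_sum_def Suc_diff_Suc)
  then have "(\<Sum>i<m. tripod_sum (Suc i) (m - Suc i))
      = (\<Sum>i<m. A_sum (Suc i) (m - i) - A_sum (Suc (Suc i)) (m - Suc i))"
    by simp
  also have "\<dots> = A_sum (Suc 0) m - A_sum (Suc m) 0"
    using sum_lessThan_telescope'[of "\<lambda>i. A_sum (Suc i) (m - i)" m] by simp
  finally show ?thesis by (simp add: A_sum_left_1 A_sum_right_0)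
qed

lemma tripod_sum_left_1:
  "tripod_sum 1 r = 2 * D_sum (Suc (Suc r)) + D_sum (Suc r) - x\<^sup>2 * D_sum r"
proof -
  have "A_sum r (Suc 0) = D_sum (Suc r) + D_sum (Suc (Suc r))"
    using tripod_sum_commute[of r 0] by (simp add: tripod_sum_left_0 A_sum_right_0) (simp add:
        tripod_sum_def A_sum_right_0 algebra_simps)
  then show ?thesis
    using tripod_sum_difference[of 0 r]
    by (simp add: tripod_sum_left_0 A_sum_left_0 A_sum_right_0 power2_eq_square algebra_simps)
qed

text \<open>
  The difference of two consecutive instances of the rule for moving the vertex. The rotated
  terms of the family \<open>\<A>\<close> combine to trivalent diagrams seen from the other side, which the
  symmetry of \<open>tripod_sum\<close> identifies with the unrotated ones; hence the coefficient 2 of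
  \<open>x\<close>.
\<close>

lemma tripod_sum_recursion:
  "tripod_sum (Suc (Suc k)) r = 2 * tripod_sum (Suc k) (Suc r) - tripod_sum k (Suc (Suc r))
     + tripod_sum (Suc k) r + tripod_sum k (Suc r) + 2 * x * tripod_sum k r"
proof -
  have "tripod_sum (Suc k) r = tripod_sum r (Suc k)" "x * tripod_sum k r = x * tripod_sum r k"
    by (simp_all only: tripod_sum_commute[of _ r])
  then have sym: "tripod_sum (Suc k) r = A_sum r (Suc (Suc k)) - A_sum (Suc r) (Suc k)"
    "x * tripod_sum k r = x * A_sum r (Suc k) - x * A_sum (Suc r) k"
    by (simp_all add: tripod_sum_def right_diff_distrib)
  have direct: "tripod_sum k (Suc r) = A_sum k (Suc (Suc r)) - A_sum (Suc k) (Suc r)"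
    "x * tripod_sum k r = x * A_sum k (Suc r) - x * A_sum (Suc k) r"
    by (simp_all add: tripod_sum_def right_diff_distrib)
  show ?thesis
    using tripod_sum_difference[of k "Suc r"] tripod_sum_difference[of "Suc k" r] sym direct
    by (simp only: mult.assoc) (simp only: mult_2 ring_distribs, algebra)
qed

text \<open>
  Both sides obey the same recursion, first in the number \<open>N + 1\<close> of chords and then in the
  position of the trivalent vertex.
\<close>

lemma K_poly_value:
  assumes x: "x = of_int z"
  shows "of_int (poly (K_poly (Suc (k + r)) (Suc k)) z) = tripod_sum k r"
proof -
  let ?v = "\<lambda>p. of_int (poly p z) :: complex"
  have "\<forall>k r. k + r = N \<longrightarrow> ?v (K_poly (Suc N) (Suc k)) = tripod_sum k r" for N
  proof (induction N rule: less_induct)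
    case (less N)
    have IH: "?v (K_poly (Suc (k + r)) (Suc k)) = tripod_sum k r" if "k + r < N" for k r
      using less[OF that] by blast
    have D: "?v (K_poly n 1) = D_sum n" if "n \<le> N" for n
    proof (cases n)
      case (Suc m)
      then show ?thesis using IH[of 0 m] that by (simp add: tripod_sum_left_0)
    qed (simp add: K_poly_recursion[simplified] D_sum_0)
    have K1: "?v (K_poly (Suc N) 1) = tripod_sum 0 N"
    proof (cases N)
      case 0
      then show ?thesis
        using A_sum_left_0[of 0] by (simp add: K_poly_recursion[simplified] tripod_sum_left_0
            D_sum_0 x flip: A_sum_right_0)
    next
      case (Suc m)
      have "(\<Sum>i<m. ?v (K_poly (Suc m) (Suc (Suc i)))) = (\<Sum>i<m. tripod_sum (Suc i) (m - Suc i))"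
      proof (intro sum.cong refl)
        fix i assume "i \<in> {..<m}"
        then show "?v (K_poly (Suc m) (Suc (Suc i))) = tripod_sum (Suc i) (m - Suc i)"
          using IH[of "Suc i" "m - Suc i"] Suc by simp
      qed
      then show ?thesis
        using D[of "Suc m"] Suc
        by (simp add: K_poly_recursion(3)[simplified] tripod_sum_telescope tripod_sum_left_0 poly_sum x)
    qed
    have "?v (K_poly (Suc N) (Suc k)) = tripod_sum k r" if "k + r = N" for k r
      using that
    proof (induction k arbitrary: r rule: less_induct)
      case (less k)
      consider "k = 0" | "k = 1" | j where "k = Suc (Suc j)"
        by (metis One_nat_def not0_implies_Suc)
      then show ?case
      proof cases
        case 1
        then show ?thesis using K1 less.prems by simp
      next
        case 2
        then have N: "N = Suc r" using less.prems by simp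
        then have "?v (K_poly (Suc N) (Suc k)) = 2 * ?v (K_poly (Suc N) 1) + ?v (K_poly (Suc r) 1)
            - x^2 * ?v (K_poly r 1)"
          using K_poly_recursion(4)[of r] by (simp add: 2 x numeral_2_eq_2)
        also have "\<dots> = tripod_sum k r"
          unfolding K1 using D[of "Suc r"] D[of r] by (simp add: N 2 tripod_sum_left_0
              tripod_sum_left_1[simplified])
        finally show ?thesis .
      next
        case (3 j)
        then have N: "N = Suc (Suc (j + r))" using less.prems by simp
        have "?v (K_poly (Suc N) (Suc k)) = 2 * ?v (K_poly (Suc N) (Suc (Suc j)))
            - ?v (K_poly (Suc N) (Suc j))
            + ?v (K_poly N (Suc (Suc j))) + ?v (K_poly N (Suc j)) + 2 * x * ?v (K_poly (Suc (j
                + r)) (Suc j))"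
          unfolding N 3 K_poly_recursion(5) by (simp add: x)
        also have "?v (K_poly (Suc N) (Suc (Suc j))) = tripod_sum (Suc j) (Suc r)"
          by (rule less.IH) (simp_all add: 3 N)
        also have "?v (K_poly (Suc N) (Suc j)) = tripod_sum j (Suc (Suc r))"
          by (rule less.IH) (simp_all add: 3 N)
        also have "?v (K_poly N (Suc (Suc j))) = tripod_sum (Suc j) r"
          using IH[of "Suc j" r] by (simp add: N)
        also have "?v (K_poly N (Suc j)) = tripod_sum j (Suc r)"
          using IH[of j "Suc r"] by (simp add: N)
        also have "?v (K_poly (Suc (j + r)) (Suc j)) = tripod_sum j r"
          using IH[of j r] by (simp add: N)
        finally show ?thesis
          by (simp only: 3 tripod_sum_recursion)
      qed
    qed
    then show ?case by blast
  qed
  then show ?thesis by blast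
qed

lemma K_poly_value_1:
  assumes "x = of_int z"
  shows "of_int (poly (K_poly n 1) z) = D_sum n"
proof (cases n)
  case 0
  then show ?thesis by (simp add: K_poly_recursion(1)[simplified] D_sum_0)
next
  case (Suc m)
  then show ?thesis using K_poly_value[OF assms, of 0 m] by (simp add: tripod_sum_left_0)
qed

end

lemma A_diagram_valid: "chord_diagram (A_diagram (Suc (k + r)) k)" "A_diagram (Suc (k + r)) k \<noteq> {}"
  unfolding A_diagram_word diagram_of_word_map[OF inj_Suc] diagram_of_word_eq[OF A_word]
  using chord_diagram_of_word[OF A_word, of k r] unfolding diagram_of_word_eq[OF A_word] by auto

lemma B_diagram_valid: "chord_diagram (B_diagram (Suc (Suc (k + r))) k)" "B_diagram (Suc (Suc (k
    + r))) k \<noteq> {}"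
  unfolding B_diagram_word diagram_of_word_map[OF inj_Suc] diagram_of_word_eq[OF B_word]
  using chord_diagram_of_word[OF B_word, of k r] unfolding diagram_of_word_eq[OF B_word] by auto

lemma D_diagram_valid: "chord_diagram (D_diagram n)" "n \<noteq> 0 \<Longrightarrow> D_diagram n \<noteq> {}"
  unfolding D_diagram_word diagram_of_word_map[OF inj_Suc] diagram_of_word_eq[OF D_word]
  using chord_diagram_of_word[OF D_word, of n] unfolding diagram_of_word_eq[OF D_word] by auto

lemma (in casimir_functional) poly_values:
  assumes x: "x = of_int z"
  shows "of_int (poly (phi (A_diagram (Suc (k + r)) k)) z) = A_sum k r"
    and "of_int (poly (phi (B_diagram (Suc (Suc (k + r))) k)) z) = B_sum k r"
    and "of_int (poly (D_poly n) z) = D_sum n"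
proof -
  have functional: "casimir_functional L (of_int z)"
    using casimir_functional_axioms by (simp add: x)
  note phi = phi_eval[OF functional]
  show "of_int (poly (phi (A_diagram (Suc (k + r)) k)) z) = A_sum k r"
    unfolding phi[OF A_diagram_valid] by (rule colour_sum_A_diagram)
  show "of_int (poly (phi (B_diagram (Suc (Suc (k + r))) k)) z) = B_sum k r"
    unfolding phi[OF B_diagram_valid] by (rule colour_sum_B_diagram)
  show "of_int (poly (D_poly n) z) = D_sum n"
    using phi[OF D_diagram_valid(1), of n] D_diagram_valid(2)[of n] colour_sum_D_diagram[of n]
    by (cases "n = 0") (simp_all add: D_poly_def D_sum_0)
qed

text \<open>
  An integer polynomial is determined by its values at the integers, and each integer is the
  Casimir value of a functional.
\<close>

lemma poly_eqI_spin:
  assumes "\<And>L z. casimir_functional L (of_int z) \<Longrightarrow> (of_int (poly p z) :: complex) = of_int (poly q z)"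
  shows "p = (q :: int poly)"
proof -
  have "poly p z = poly q z" for z
    using assms[OF spin_word_functional, of z] by simp
  then show ?thesis by (simp add: poly_eq_poly_eq_iff[symmetric] fun_eq_iff)
qed

theorem theorem8:
  fixes n k :: nat
  assumes "1 \<le> n" and "k \<le> n - 1"
  shows "A_poly n (int k - 1) - A_poly n (int k) = K_poly (n - 1) k
    \<and> B_poly n (int k - 1) - B_poly n (int n - int k - 1) = K_poly n k - K_poly n (k + 1)"
proof (cases k)
  case 0
  obtain m where n: "n = Suc m" using assms(1) by (cases n) auto
  have K0: "K_poly i 0 = - X * K_poly i 1" for i by (subst K_poly.simps) simp
  have D: "K_poly i 1 = D_poly i" for i
  proof (rule poly_eqI_spin)
    fix L z assume "casimir_functional L (of_int z)"
    then interpret casimir_functional L "of_int z" .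
    show "(of_int (poly (K_poly i 1) z) :: complex) = of_int (poly (D_poly i) z)"
      by (simp only: K_poly_value_1 poly_values)
  qed
  have A: "phi (A_diagram (Suc m) 0) = X * D_poly m"
  proof (rule poly_eqI_spin)
    fix L z assume "casimir_functional L (of_int z)"
    then interpret casimir_functional L "of_int z" .
    show "(of_int (poly (phi (A_diagram (Suc m) 0)) z) :: complex) = of_int (poly (X * D_poly m) z)"
      using poly_values(1)[of z 0 m] poly_values(3)[of z m] by (simp add: A_sum_left_0)
  qed
  have B: "phi (B_diagram (Suc m) m) = D_poly (Suc m)"
    by (simp add: B_diagram_def D_poly_def)
  have "A_poly n (int k - 1) - A_poly n (int k) = K_poly (n - 1) k"
    unfolding n 0 K0 using A by (simp add: A_poly_def D[simplified])
  moreover have "B_poly n (int k - 1) - B_poly n (int n - int k - 1) = K_poly n k - K_poly n (k + 1)"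
    unfolding n 0 K0 using B by (simp add: B_poly_def D[simplified])
  ultimately show ?thesis ..
next
  case (Suc j)
  define r where "r = n - Suc (Suc j)"
  have n: "n = Suc (Suc (j + r))" using assms Suc by (simp add: r_def)
  have A: "A_poly n (int k - 1) = phi (A_diagram (Suc (j + Suc r)) j)"
    "A_poly n (int k) = phi (A_diagram (Suc (Suc j + r)) (Suc j))"
    by (simp_all add: A_poly_def n Suc nat_add_distrib)
  have idx: "nat (int n - int k - 1) = r" "int n - int k - 1 \<noteq> -1" by (simp_all add: n Suc)
  have B: "B_poly n (int k - 1) = phi (B_diagram (Suc (Suc (j + r))) j)"
    "B_poly n (int n - int k - 1) = phi (B_diagram (Suc (Suc (r + j))) r)"
    using idx by (simp_all add: B_poly_def n Suc add.commute)
  have K: "K_poly (n - 1) k = K_poly (Suc (j + r)) (Suc j)" "K_poly n k = K_poly (Suc (j + Suc r)) (Suc j)"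
    "K_poly n (k + 1) = K_poly (Suc (Suc j + r)) (Suc (Suc j))"
    by (simp_all add: n Suc)
  show ?thesis
  proof
    show "A_poly n (int k - 1) - A_poly n (int k) = K_poly (n - 1) k"
    proof (rule poly_eqI_spin)
      fix L z assume "casimir_functional L (of_int z)"
      then interpret casimir_functional L "of_int z" .
      show "(of_int (poly (A_poly n (int k - 1) - A_poly n (int k)) z) :: complex)
          = of_int (poly (K_poly (n - 1) k) z)"
        unfolding A K poly_diff of_int_diff by (simp only: poly_values K_poly_value tripod_sum_def)
    qed
    show "B_poly n (int k - 1) - B_poly n (int n - int k - 1) = K_poly n k - K_poly n (k + 1)"
    proof (rule poly_eqI_spin)
      fix L z assume "casimir_functional L (of_int z)"
      then interpret casimir_functional L "of_int z" .
      show "(of_int (poly (B_poly n (int k - 1) - B_poly n (int n - int k - 1)) z) :: complex)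
          = of_int (poly (K_poly n k - K_poly n (k + 1)) z)"
        unfolding B K poly_diff of_int_diff by (simp only: poly_values K_poly_value B_sum_difference)
    qed
  qed
qed

end
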